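(* Let $\mu_1,\mu_2\in\mathbb{C}$ with $\mu_1+\mu_2\notin\mathbb{Z}$. Then $M_{\mu_1,\mu_2}\cong M_{\mu_1,\mu_2}^{\vee}$ as $\mathfrak{sl}_3$-modules if and only if $\mu_1\notin\mathbb{Z}$ and $\mu_2\notin\mathbb{Z}$.
   Context: $\mathfrak{sl}_3$ is the complex Lie algebra with root vectors $e_1,e_2,e_{12}=[e_1,e_2]$ (roots $\alpha_1,\alpha_2,\alpha_1+\alpha_2$), $f_1,f_2,f_{12}=-[f_1,f_2]$ (the negative roots), and simple coroots $h_1,h_2$ spanning the Cartan subalgebra $\mathfrak{t}$; e.g. $e_1=E_{12}$, $e_2=E_{23}$, $e_{12}=E_{13}$, $f_1=E_{21}$, $f_2=E_{32}$, $f_{12}=E_{31}$. For $\mu_1,\mu_2\in\mathbb{C}$ the $\mathfrak{sl}_3$-module $M_{\mu_1,\mu_2}$ is the space of global sections of a rank one local system on $O=X_{w_\circ}\cap s_1X_{w_\circ}\cap s_2X_{w_\circ}\cong\mathbb{G}_m^2\times\mathbb{A}^1$ ($X_{w_\circ}$ the big cell of the flag variety of $\mathrm{SL}_3$), on which $\mathfrak{sl}_3$ acts by infinitesimal left translations. Explicitly, write $\overline{k}=k-\mu_1$ and $\overline{l}=l-\mu_2$. Then $M_{\mu_1,\mu_2}$ has the $\mathbb{C}$-basis $u_{k,l,m}$, $k,l\in\mathbb{Z}$, $m\in\mathbb{Z}_{\ge0}$, with action $$e_1u_{k,l,m}=-\overline{k}\,u_{k-1,l,m},\qquad e_2u_{k,l,m}=-\overline{l}\,u_{k,l-1,m}+m\,u_{k+1,l,m-1},$$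 $$h\,u_{k,l,m}=-\big((\overline{k}+m)\alpha_1(h)+(\overline{l}+m)\alpha_2(h)\big)u_{k,l,m}\quad(h\in\mathfrak{t}),$$ $$f_1u_{k,l,m}=(\overline{k}-\overline{l}+m)u_{k+1,l,m}-\overline{l}\,u_{k,l-1,m+1},\qquad f_2u_{k,l,m}=\overline{l}\,u_{k,l+1,m}+\overline{k}\,u_{k-1,l,m+1},$$ $$e_{12}u_{k,l,m}=-m\,u_{k,l,m-1},\qquad f_{12}u_{k,l,m}=(\overline{k}+\overline{l}+m)u_{k,l,m+1}+\overline{l}\,u_{k+1,l+1,m}$$ (terms with coefficient $m=0$ are zero). When $\mu_1+\mu_2\notin\mathbb{Z}$ the vectors $$w_{k,l,m}=\sum_{n=0}^m\binom{m}{n}\frac{\overline{l}^{(n)}}{(\overline{k}+\overline{l})^{(n)}}\,u_{k+n,l+n,m-n},\qquad x^{(n)}=x(x+1)\cdots(x+n-1),$$ form a basis of $M_{\mu_1,\mu_2}$ of simultaneous eigenvectors for $(h_1,h_2,f_{12}e_{12})$ with pairwise distinct simultaneous eigenvalues. Dual: if an $\mathfrak{sl}_3$-module $M$ is the direct sum of its finite dimensional simultaneous $(h_1,h_2,f_{12}e_{12})$-eigenspaces $M_\chi$ (which is thus the case for $M_{\mu_1,\mu_2}$), its dual is $M^\vee=\bigoplus_\chi\mathrm{Hom}_{\mathbb{C}}(M_\chi,\mathbb{C})$ with action $(X\eta)(v)=-\eta(\tau(X)v)$ for $X\in\mathfrak{sl}_3$, where $\tau$ is the involutive automorphism of $\mathfrak{sl}_3$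 given by $h_1\mapsto-h_1$, $h_2\mapsto-h_2$, $f_1\leftrightarrow e_1$, $f_2\leftrightarrow e_2$, $-f_{12}\leftrightarrow e_{12}$ (functionals on $M_\chi$ are extended by zero to the other eigenspaces). *)

theory Defs
  imports "HOL-Analysis.Analysis" "HOL-Library.Poly_Mapping" "HOL-Library.Function_Algebras"
begin

definition sl3 :: "(complex^3^3) set" where
  "sl3 = {X. trace X = 0}"

definition lie_bracket :: "complex^3^3 \<Rightarrow> complex^3^3 \<Rightarrow> complex^3^3" where
  "lie_bracket X Y = X ** Y - Y ** X"

definition mat_scale :: "complex \<Rightarrow> complex^3^3 \<Rightarrow> complex^3^3" where
  "mat_scale c X = (\<chi> i j. c * X $ i $ j)"

definition mat_unit :: "3 \<Rightarrow> 3 \<Rightarrow> complex^3^3" where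
  "mat_unit i j = (\<chi> a b. if a = i \<and> b = j then 1 else 0)"

definition "e\<^sub>1 = mat_unit 1 2"
definition "e\<^sub>2 = mat_unit 2 3"
definition "e\<^sub>1\<^sub>2 = mat_unit 1 3"
definition "f\<^sub>1 = mat_unit 2 1"
definition "f\<^sub>2 = mat_unit 3 2"
definition "f\<^sub>1\<^sub>2 = mat_unit 3 1"
definition "h\<^sub>1 = mat_unit 1 1 - mat_unit 2 2"
definition "h\<^sub>2 = mat_unit 2 2 - mat_unit 3 3"

lemmas sl3_generator_defs =
  e\<^sub>1_def e\<^sub>2_def e\<^sub>1\<^sub>2_def f\<^sub>1_def f\<^sub>2_def f\<^sub>1\<^sub>2_def h\<^sub>1_def h\<^sub>2_def

text \<open>The linear map exchanging \<open>e\<^sub>1 \<leftrightarrow> f\<^sub>1\<close>, \<open>e\<^sub>2 \<leftrightarrow> f\<^sub>2\<close>, \<open>e\<^sub>1\<^sub>2 \<leftrightarrow> - f\<^sub>1\<^sub>2\<close> and negating the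
  diagonal, in matrix entries.\<close>

definition tau :: "complex^3^3 \<Rightarrow> complex^3^3" where
  "tau X = vector
     [vector [- X $ 1 $ 1,   X $ 2 $ 1, - X $ 3 $ 1],
      vector [  X $ 1 $ 2, - X $ 2 $ 2,   X $ 3 $ 2],
      vector [- X $ 1 $ 3,   X $ 2 $ 3, - X $ 3 $ 3]]"

lemma e12_eq: "e\<^sub>1\<^sub>2 = lie_bracket e\<^sub>1 e\<^sub>2" and f12_eq: "f\<^sub>1\<^sub>2 = - lie_bracket f\<^sub>1 f\<^sub>2"
  by (simp_all add: sl3_generator_defs lie_bracket_def mat_unit_def vec_eq_iff forall_3
      matrix_matrix_mult_def sum_3)

lemma sl3_basis_expansion:
  assumes "X \<in> sl3"
  shows "X = mat_scale (X $ 1 $ 2) e\<^sub>1 + mat_scale (X $ 2 $ 3) e\<^sub>2 + mat_scale (X $ 1 $ 3) e\<^sub>1\<^sub>2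
    + mat_scale (X $ 2 $ 1) f\<^sub>1 + mat_scale (X $ 3 $ 2) f\<^sub>2 + mat_scale (X $ 3 $ 1) f\<^sub>1\<^sub>2
    + mat_scale (X $ 1 $ 1) h\<^sub>1 + mat_scale (- X $ 3 $ 3) h\<^sub>2"
proof -
  have "X $ 2 $ 2 = - X $ 1 $ 1 - X $ 3 $ 3"
    using assms by (simp add: sl3_def trace_def sum_3 algebra_simps eq_neg_iff_add_eq_0)
  then show ?thesis
    by (simp add: sl3_generator_defs mat_unit_def mat_scale_def vec_eq_iff forall_3)
qed

lemma tau_generators:
  "tau e\<^sub>1 = f\<^sub>1" "tau f\<^sub>1 = e\<^sub>1" "tau e\<^sub>2 = f\<^sub>2" "tau f\<^sub>2 = e\<^sub>2"
  "tau e\<^sub>1\<^sub>2 = - f\<^sub>1\<^sub>2" "tau f\<^sub>1\<^sub>2 = - e\<^sub>1\<^sub>2" "tau h\<^sub>1 = - h\<^sub>1" "tau h\<^sub>2 = - h\<^sub>2"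
  by (simp_all add: tau_def sl3_generator_defs mat_unit_def vec_eq_iff forall_3)

lemma tau_sl3: "X \<in> sl3 \<Longrightarrow> tau X \<in> sl3"
proof -
  have "trace (tau X) = - trace X" by (simp add: trace_def sum_3 tau_def)
  then show "X \<in> sl3 \<Longrightarrow> tau X \<in> sl3" by (simp add: sl3_def)
qed

lemma tau_tau: "tau (tau X) = X"
  by (simp add: tau_def vec_eq_iff forall_3)

lemma tau_linear:
  "tau (X + Y) = tau X + tau Y" "tau (mat_scale c X) = mat_scale c (tau X)"
  by (simp_all add: tau_def mat_scale_def vec_eq_iff forall_3)

lemma tau_bracket: "tau (lie_bracket X Y) = lie_bracket (tau X) (tau Y)"
  by (simp add: tau_def lie_bracket_def vec_eq_iff forall_3
      matrix_matrix_mult_def sum_3 algebra_simps)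

text \<open>Addition is that of the type class; scalar multiplication and action are only relevant on the
  carrier.\<close>

record 'v sl3_rep =
  rep_carrier :: "'v set"
  rep_scale :: "complex \<Rightarrow> 'v \<Rightarrow> 'v"
  rep_act :: "complex^3^3 \<Rightarrow> 'v \<Rightarrow> 'v"

definition sl3_module :: "'v::ab_group_add sl3_rep \<Rightarrow> bool" where
  "sl3_module M \<longleftrightarrow>
     vector_space (rep_scale M) \<and> module.subspace (rep_scale M) (rep_carrier M) \<and>
     (\<forall>X\<in>sl3. \<forall>v\<in>rep_carrier M. rep_act M X v \<in> rep_carrier M) \<and>
     (\<forall>X\<in>sl3. \<forall>v\<in>rep_carrier M. \<forall>w\<in>rep_carrier M.
        rep_act M X (v + w) = rep_act M X v + rep_act M X w) \<and>
     (\<forall>X\<in>sl3. \<forall>c. \<forall>v\<in>rep_carrier M.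
        rep_act M X (rep_scale M c v) = rep_scale M c (rep_act M X v)) \<and>
     (\<forall>X\<in>sl3. \<forall>Y\<in>sl3. \<forall>v\<in>rep_carrier M.
        rep_act M (X + Y) v = rep_act M X v + rep_act M Y v) \<and>
     (\<forall>X\<in>sl3. \<forall>c. \<forall>v\<in>rep_carrier M.
        rep_act M (mat_scale c X) v = rep_scale M c (rep_act M X v)) \<and>
     (\<forall>X\<in>sl3. \<forall>Y\<in>sl3. \<forall>v\<in>rep_carrier M.
        rep_act M (lie_bracket X Y) v = rep_act M X (rep_act M Y v) - rep_act M Y (rep_act M X v))"

definition sl3_isomorphic ::
    "'v::ab_group_add sl3_rep \<Rightarrow> 'w::ab_group_add sl3_rep \<Rightarrow> bool" where
  "sl3_isomorphic M N \<longleftrightarrow>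
     (\<exists>\<phi>. bij_betw \<phi> (rep_carrier M) (rep_carrier N) \<and>
        (\<forall>v\<in>rep_carrier M. \<forall>w\<in>rep_carrier M. \<phi> (v + w) = \<phi> v + \<phi> w) \<and>
        (\<forall>c. \<forall>v\<in>rep_carrier M. \<phi> (rep_scale M c v) = rep_scale N c (\<phi> v)) \<and>
        (\<forall>X\<in>sl3. \<forall>v\<in>rep_carrier M. \<phi> (rep_act M X v) = rep_act N X (\<phi> v)))"

text \<open>The simultaneous eigenspace of \<open>(h\<^sub>1, h\<^sub>2, f\<^sub>1\<^sub>2 e\<^sub>1\<^sub>2)\<close> for the eigenvalues \<open>\<theta>\<close>.\<close>

definition joint_eigenspace ::
    "'v sl3_rep \<Rightarrow> complex \<times> complex \<times> complex \<Rightarrow> 'v set" where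
  "joint_eigenspace M = (\<lambda>(a, b, c). {v \<in> rep_carrier M.
     rep_act M h\<^sub>1 v = rep_scale M a v \<and>
     rep_act M h\<^sub>2 v = rep_scale M b v \<and>
     rep_act M f\<^sub>1\<^sub>2 (rep_act M e\<^sub>1\<^sub>2 v) = rep_scale M c v})"

text \<open>Functionals take the value 0 outside the carrier, so that a linear functional on the carrier
  is represented by exactly one function.\<close>

definition functionals :: "'v::ab_group_add sl3_rep \<Rightarrow> ('v \<Rightarrow> complex) set" where
  "functionals M = {\<eta>.
     (\<forall>v\<in>rep_carrier M. \<forall>w\<in>rep_carrier M. \<eta> (v + w) = \<eta> v + \<eta> w) \<and>
     (\<forall>c. \<forall>v\<in>rep_carrier M. \<eta> (rep_scale M c v) = c * \<eta> v) \<and>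
     (\<forall>v. v \<notin> rep_carrier M \<longrightarrow> \<eta> v = 0)}"

text \<open>When \<open>M\<close> is the direct sum of its joint eigenspaces, this is the image of
  \<open>Hom(M\<^sub>\<theta>, \<complex>)\<close> under extension by zero to the other eigenspaces.\<close>

definition eigenspace_dual ::
    "'v::ab_group_add sl3_rep \<Rightarrow> complex \<times> complex \<times> complex \<Rightarrow> ('v \<Rightarrow> complex) set" where
  "eigenspace_dual M \<theta> =
     {\<eta> \<in> functionals M. \<forall>\<psi>. \<psi> \<noteq> \<theta> \<longrightarrow> (\<forall>v\<in>joint_eigenspace M \<psi>. \<eta> v = 0)}"

definition functional_scale :: "complex \<Rightarrow> ('v \<Rightarrow> complex) \<Rightarrow> 'v \<Rightarrow> complex" where
  "functional_scale c \<eta> = (\<lambda>v. c * \<eta> v)"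

text \<open>The restricted dual \<open>\<Oplus>\<^sub>\<theta> Hom(M\<^sub>\<theta>, \<complex>)\<close>, as a space of functionals on \<open>M\<close>.  It is the intended
  object only if \<open>M\<close> is the direct sum of finite dimensional joint eigenspaces.\<close>

definition dual_rep :: "'v::ab_group_add sl3_rep \<Rightarrow> ('v \<Rightarrow> complex) sl3_rep" where
  "dual_rep M =
     \<lparr>rep_carrier = module.span functional_scale (\<Union>\<theta>. eigenspace_dual M \<theta>),
      rep_scale = functional_scale,
      rep_act = (\<lambda>X \<eta> v. if v \<in> rep_carrier M then - \<eta> (rep_act M (tau X) v) else 0)\<rparr>"

text \<open>The vector space with basis \<open>u k l m\<close>, realised as finitely supported functions.\<close>

type_synonym M_space = "(int \<times> int \<times> nat) \<Rightarrow>\<^sub>0 complex"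

definition u_basis :: "int \<Rightarrow> int \<Rightarrow> nat \<Rightarrow> M_space" where
  "u_basis k l m = Poly_Mapping.single (k, l, m) 1"

definition M_scale :: "complex \<Rightarrow> M_space \<Rightarrow> M_space" (infixr "\<cdot>" 75) where
  "c \<cdot> v = Poly_Mapping.map (\<lambda>x. c * x) v"

text \<open>The action of \<open>X\<close> on \<open>u k l m\<close>: the coordinates of \<open>X\<close> at the root vectors are its
  off-diagonal entries, and the simple roots take the values \<open>X\<^sub>1\<^sub>1 - X\<^sub>2\<^sub>2\<close>, \<open>X\<^sub>2\<^sub>2 - X\<^sub>3\<^sub>3\<close> on its diagonal
  part.  Where \<open>m - 1\<close> is truncated the coefficient vanishes.\<close>

definition M_basis_act ::
    "complex \<Rightarrow> complex \<Rightarrow> complex^3^3 \<Rightarrow> int \<times> int \<times> nat \<Rightarrow> M_space" where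
  "M_basis_act \<mu>\<^sub>1 \<mu>\<^sub>2 X = (\<lambda>(k, l, m).
     let k' = of_int k - \<mu>\<^sub>1; l' = of_int l - \<mu>\<^sub>2; m' = of_nat m in
       X $ 1 $ 2 \<cdot> ((- k') \<cdot> u_basis (k - 1) l m)
     + X $ 2 $ 3 \<cdot> ((- l') \<cdot> u_basis k (l - 1) m + m' \<cdot> u_basis (k + 1) l (m - 1))
     + X $ 1 $ 3 \<cdot> ((- m') \<cdot> u_basis k l (m - 1))
     + X $ 2 $ 1 \<cdot> ((k' - l' + m') \<cdot> u_basis (k + 1) l m - l' \<cdot> u_basis k (l - 1) (m + 1))
     + X $ 3 $ 2 \<cdot> (l' \<cdot> u_basis k (l + 1) m + k' \<cdot> u_basis (k - 1) l (m + 1))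
     + X $ 3 $ 1 \<cdot> ((k' + l' + m') \<cdot> u_basis k l (m + 1) + l' \<cdot> u_basis (k + 1) (l + 1) m)
     + (- ((k' + m') * (X $ 1 $ 1 - X $ 2 $ 2) + (l' + m') * (X $ 2 $ 2 - X $ 3 $ 3))) \<cdot> u_basis k l m)"

definition M_act :: "complex \<Rightarrow> complex \<Rightarrow> complex^3^3 \<Rightarrow> M_space \<Rightarrow> M_space" where
  "M_act \<mu>\<^sub>1 \<mu>\<^sub>2 X v = (\<Sum>b\<in>Poly_Mapping.keys v. Poly_Mapping.lookup v b \<cdot> M_basis_act \<mu>\<^sub>1 \<mu>\<^sub>2 X b)"

definition M_rep :: "complex \<Rightarrow> complex \<Rightarrow> M_space sl3_rep" where
  "M_rep \<mu>\<^sub>1 \<mu>\<^sub>2 = \<lparr>rep_carrier = UNIV, rep_scale = M_scale, rep_act = M_act \<mu>\<^sub>1 \<mu>\<^sub>2\<rparr>"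

lemma lookup_M_scale [simp]: "Poly_Mapping.lookup (c \<cdot> v) b = c * Poly_Mapping.lookup v b"
  by (simp add: M_scale_def map.rep_eq when_def)

lemma M_scale_laws:
  "c \<cdot> (v + w) = c \<cdot> v + c \<cdot> w" "(c + d) \<cdot> v = c \<cdot> v + d \<cdot> v" "c \<cdot> d \<cdot> v = (c * d) \<cdot> v"
  "1 \<cdot> v = v" "0 \<cdot> v = 0" "c \<cdot> 0 = 0" "c \<cdot> (v - w) = c \<cdot> v - c \<cdot> w"
  by (rule poly_mapping_eqI; simp add: lookup_add lookup_minus algebra_simps)+

lemma M_vector_space: "vector_space M_scale"
  by unfold_locales (simp_all add: M_scale_laws)

lemma M_act_superset:
  assumes "finite S" "Poly_Mapping.keys v \<subseteq> S"
  shows "M_act \<mu>\<^sub>1 \<mu>\<^sub>2 X v = (\<Sum>b\<in>S. Poly_Mapping.lookup v b \<cdot> M_basis_act \<mu>\<^sub>1 \<mu>\<^sub>2 X b)"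
  unfolding M_act_def
  by (rule sum.mono_neutral_left) (use assms in \<open>auto simp: M_scale_laws not_in_keys_iff_lookup_eq_zero\<close>)

lemma M_act_add: "M_act \<mu>\<^sub>1 \<mu>\<^sub>2 X (v + w) = M_act \<mu>\<^sub>1 \<mu>\<^sub>2 X v + M_act \<mu>\<^sub>1 \<mu>\<^sub>2 X w"
proof -
  let ?S = "Poly_Mapping.keys v \<union> Poly_Mapping.keys w"
  have "M_act \<mu>\<^sub>1 \<mu>\<^sub>2 X (v + w) =
      (\<Sum>b\<in>?S. Poly_Mapping.lookup (v + w) b \<cdot> M_basis_act \<mu>\<^sub>1 \<mu>\<^sub>2 X b)"
    by (rule M_act_superset) (use Poly_Mapping.keys_add[of v w] in auto)
  also have "\<dots> = (\<Sum>b\<in>?S. Poly_Mapping.lookup v b \<cdot> M_basis_act \<mu>\<^sub>1 \<mu>\<^sub>2 X b)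
      + (\<Sum>b\<in>?S. Poly_Mapping.lookup w b \<cdot> M_basis_act \<mu>\<^sub>1 \<mu>\<^sub>2 X b)"
    by (simp add: lookup_add M_scale_laws sum.distrib)
  also have "\<dots> = M_act \<mu>\<^sub>1 \<mu>\<^sub>2 X v + M_act \<mu>\<^sub>1 \<mu>\<^sub>2 X w"
    by (subst (1 2) M_act_superset[of ?S]) auto
  finally show ?thesis .
qed

lemma M_act_scale: "M_act \<mu>\<^sub>1 \<mu>\<^sub>2 X (c \<cdot> v) = c \<cdot> M_act \<mu>\<^sub>1 \<mu>\<^sub>2 X v"
proof -
  interpret vector_space M_scale by (rule M_vector_space)
  have "M_act \<mu>\<^sub>1 \<mu>\<^sub>2 X (c \<cdot> v) =
      (\<Sum>b\<in>Poly_Mapping.keys v. Poly_Mapping.lookup (c \<cdot> v) b \<cdot> M_basis_act \<mu>\<^sub>1 \<mu>\<^sub>2 X b)"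
    by (rule M_act_superset) (auto simp: in_keys_iff)
  then show ?thesis
    by (simp add: M_act_def scale_sum_right)
qed

lemma M_act_u_basis: "M_act \<mu>\<^sub>1 \<mu>\<^sub>2 X (u_basis k l m) = M_basis_act \<mu>\<^sub>1 \<mu>\<^sub>2 X (k, l, m)"
  by (simp add: M_act_def u_basis_def M_scale_laws)

lemma M_act_diff: "M_act \<mu>\<^sub>1 \<mu>\<^sub>2 X (v - w) = M_act \<mu>\<^sub>1 \<mu>\<^sub>2 X v - M_act \<mu>\<^sub>1 \<mu>\<^sub>2 X w"
  using M_act_add[of \<mu>\<^sub>1 \<mu>\<^sub>2 X "v - w" w] by simp

lemma M_act_matrix_linear:
  "M_act \<mu>\<^sub>1 \<mu>\<^sub>2 (X + Y) v = M_act \<mu>\<^sub>1 \<mu>\<^sub>2 X v + M_act \<mu>\<^sub>1 \<mu>\<^sub>2 Y v"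
  "M_act \<mu>\<^sub>1 \<mu>\<^sub>2 (mat_scale c X) v = c \<cdot> M_act \<mu>\<^sub>1 \<mu>\<^sub>2 X v"
proof -
  interpret vector_space M_scale by (rule M_vector_space)
  have "M_basis_act \<mu>\<^sub>1 \<mu>\<^sub>2 (X + Y) b = M_basis_act \<mu>\<^sub>1 \<mu>\<^sub>2 X b + M_basis_act \<mu>\<^sub>1 \<mu>\<^sub>2 Y b" for b
    by (rule poly_mapping_eqI)
      (simp add: M_basis_act_def Let_def lookup_add lookup_minus algebra_simps split: prod.split)
  then show "M_act \<mu>\<^sub>1 \<mu>\<^sub>2 (X + Y) v = M_act \<mu>\<^sub>1 \<mu>\<^sub>2 X v + M_act \<mu>\<^sub>1 \<mu>\<^sub>2 Y v"
    by (simp add: M_act_def M_scale_laws sum.distrib)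
  have "M_basis_act \<mu>\<^sub>1 \<mu>\<^sub>2 (mat_scale c X) b = c \<cdot> M_basis_act \<mu>\<^sub>1 \<mu>\<^sub>2 X b" for b
    by (rule poly_mapping_eqI)
      (simp add: M_basis_act_def Let_def mat_scale_def lookup_add lookup_minus algebra_simps
        split: prod.split)
  then show "M_act \<mu>\<^sub>1 \<mu>\<^sub>2 (mat_scale c X) v = c \<cdot> M_act \<mu>\<^sub>1 \<mu>\<^sub>2 X v"
    by (simp add: M_act_def scale_sum_right M_scale_laws mult.commute)
qed

definition "sl3_generators = {e\<^sub>1, e\<^sub>2, e\<^sub>1\<^sub>2, f\<^sub>1, f\<^sub>2, f\<^sub>1\<^sub>2, h\<^sub>1, h\<^sub>2}"

lemma sl3_generator_induct:
  assumes "X \<in> sl3" "\<And>X. X \<in> sl3_generators \<Longrightarrow> P X"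
    and "\<And>X Y. P X \<Longrightarrow> P Y \<Longrightarrow> P (X + Y)" "\<And>c X. P X \<Longrightarrow> P (mat_scale c X)"
  shows "P X"
  by (subst sl3_basis_expansion[OF assms(1)]) (intro assms(2-); simp add: sl3_generators_def)

lemma M_act_generators:
  "M_act \<mu>\<^sub>1 \<mu>\<^sub>2 e\<^sub>1 (u_basis k l m) = (- (of_int k - \<mu>\<^sub>1)) \<cdot> u_basis (k - 1) l m"
  "M_act \<mu>\<^sub>1 \<mu>\<^sub>2 e\<^sub>2 (u_basis k l m) =
     (- (of_int l - \<mu>\<^sub>2)) \<cdot> u_basis k (l - 1) m + of_nat m \<cdot> u_basis (k + 1) l (m - 1)"
  "M_act \<mu>\<^sub>1 \<mu>\<^sub>2 e\<^sub>1\<^sub>2 (u_basis k l m) = (- of_nat m) \<cdot> u_basis k l (m - 1)"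
  "M_act \<mu>\<^sub>1 \<mu>\<^sub>2 f\<^sub>1 (u_basis k l m) =
     ((of_int k - \<mu>\<^sub>1) - (of_int l - \<mu>\<^sub>2) + of_nat m) \<cdot> u_basis (k + 1) l m
     - (of_int l - \<mu>\<^sub>2) \<cdot> u_basis k (l - 1) (m + 1)"
  "M_act \<mu>\<^sub>1 \<mu>\<^sub>2 f\<^sub>2 (u_basis k l m) =
     (of_int l - \<mu>\<^sub>2) \<cdot> u_basis k (l + 1) m + (of_int k - \<mu>\<^sub>1) \<cdot> u_basis (k - 1) l (m + 1)"
  "M_act \<mu>\<^sub>1 \<mu>\<^sub>2 f\<^sub>1\<^sub>2 (u_basis k l m) =
     ((of_int k - \<mu>\<^sub>1) + (of_int l - \<mu>\<^sub>2) + of_nat m) \<cdot> u_basis k l (m + 1)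
     + (of_int l - \<mu>\<^sub>2) \<cdot> u_basis (k + 1) (l + 1) m"
  "M_act \<mu>\<^sub>1 \<mu>\<^sub>2 h\<^sub>1 (u_basis k l m) =
     (- (2 * ((of_int k - \<mu>\<^sub>1) + of_nat m) - ((of_int l - \<mu>\<^sub>2) + of_nat m))) \<cdot> u_basis k l m"
  "M_act \<mu>\<^sub>1 \<mu>\<^sub>2 h\<^sub>2 (u_basis k l m) =
     (- (2 * ((of_int l - \<mu>\<^sub>2) + of_nat m) - ((of_int k - \<mu>\<^sub>1) + of_nat m))) \<cdot> u_basis k l m"
  by (rule poly_mapping_eqI; simp add: M_act_u_basis M_basis_act_def Let_def sl3_generator_defs
      mat_unit_def lookup_add lookup_minus algebra_simps)+

definition bracket_compatible ::
    "complex \<Rightarrow> complex \<Rightarrow> complex^3^3 \<Rightarrow> complex^3^3 \<Rightarrow> M_space \<Rightarrow> bool" where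
  "bracket_compatible \<mu>\<^sub>1 \<mu>\<^sub>2 X Y v \<longleftrightarrow> M_act \<mu>\<^sub>1 \<mu>\<^sub>2 (lie_bracket X Y) v =
     M_act \<mu>\<^sub>1 \<mu>\<^sub>2 X (M_act \<mu>\<^sub>1 \<mu>\<^sub>2 Y v) - M_act \<mu>\<^sub>1 \<mu>\<^sub>2 Y (M_act \<mu>\<^sub>1 \<mu>\<^sub>2 X v)"

lemma lie_bracket_generators:
  "lie_bracket e\<^sub>1 e\<^sub>2 = e\<^sub>1\<^sub>2" "lie_bracket e\<^sub>1 e\<^sub>1\<^sub>2 = 0"
  "lie_bracket e\<^sub>1 f\<^sub>1 = h\<^sub>1" "lie_bracket e\<^sub>1 f\<^sub>2 = 0"
  "lie_bracket e\<^sub>1 f\<^sub>1\<^sub>2 = mat_scale (-1) f\<^sub>2" "lie_bracket e\<^sub>1 h\<^sub>1 = mat_scale (-2) e\<^sub>1"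
  "lie_bracket e\<^sub>1 h\<^sub>2 = e\<^sub>1"
  "lie_bracket e\<^sub>2 e\<^sub>1\<^sub>2 = 0" "lie_bracket e\<^sub>2 f\<^sub>1 = 0"
  "lie_bracket e\<^sub>2 f\<^sub>2 = h\<^sub>2" "lie_bracket e\<^sub>2 f\<^sub>1\<^sub>2 = f\<^sub>1"
  "lie_bracket e\<^sub>2 h\<^sub>1 = e\<^sub>2" "lie_bracket e\<^sub>2 h\<^sub>2 = mat_scale (-2) e\<^sub>2"
  "lie_bracket e\<^sub>1\<^sub>2 f\<^sub>1 = mat_scale (-1) e\<^sub>2" "lie_bracket e\<^sub>1\<^sub>2 f\<^sub>2 = e\<^sub>1"
  "lie_bracket e\<^sub>1\<^sub>2 f\<^sub>1\<^sub>2 = h\<^sub>1 + h\<^sub>2" "lie_bracket e\<^sub>1\<^sub>2 h\<^sub>1 = mat_scale (-1) e\<^sub>1\<^sub>2"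
  "lie_bracket e\<^sub>1\<^sub>2 h\<^sub>2 = mat_scale (-1) e\<^sub>1\<^sub>2"
  "lie_bracket f\<^sub>1 f\<^sub>2 = mat_scale (-1) f\<^sub>1\<^sub>2" "lie_bracket f\<^sub>1 f\<^sub>1\<^sub>2 = 0"
  "lie_bracket f\<^sub>1 h\<^sub>1 = mat_scale 2 f\<^sub>1" "lie_bracket f\<^sub>1 h\<^sub>2 = mat_scale (-1) f\<^sub>1"
  "lie_bracket f\<^sub>2 f\<^sub>1\<^sub>2 = 0" "lie_bracket f\<^sub>2 h\<^sub>1 = mat_scale (-1) f\<^sub>2"
  "lie_bracket f\<^sub>2 h\<^sub>2 = mat_scale 2 f\<^sub>2"
  "lie_bracket f\<^sub>1\<^sub>2 h\<^sub>1 = f\<^sub>1\<^sub>2" "lie_bracket f\<^sub>1\<^sub>2 h\<^sub>2 = f\<^sub>1\<^sub>2"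
  "lie_bracket h\<^sub>1 h\<^sub>2 = 0"
  by (simp_all add: lie_bracket_def sl3_generator_defs mat_unit_def mat_scale_def vec_eq_iff forall_3
      matrix_matrix_mult_def sum_3)

lemma M_act_zero_matrix: "M_act \<mu>\<^sub>1 \<mu>\<^sub>2 0 v = 0"
proof -
  have "mat_scale 0 0 = 0" by (simp add: mat_scale_def vec_eq_iff)
  then show ?thesis
    using M_act_matrix_linear(2)[of \<mu>\<^sub>1 \<mu>\<^sub>2 0 0 v] by (simp add: M_scale_laws)
qed

abbreviation (input) generator_pair :: "complex^3^3 \<Rightarrow> complex^3^3 \<Rightarrow> bool" where
  "generator_pair X Y \<equiv>
     X = e\<^sub>1 \<and> Y \<in> {e\<^sub>2, e\<^sub>1\<^sub>2, f\<^sub>1, f\<^sub>2, f\<^sub>1\<^sub>2, h\<^sub>1, h\<^sub>2} \<or> X = e\<^sub>2 \<and> Y \<in> {e\<^sub>1\<^sub>2, f\<^sub>1, f\<^sub>2, f\<^sub>1\<^sub>2, h\<^sub>1, h\<^sub>2} \<or>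
     X = e\<^sub>1\<^sub>2 \<and> Y \<in> {f\<^sub>1, f\<^sub>2, f\<^sub>1\<^sub>2, h\<^sub>1, h\<^sub>2} \<or> X = f\<^sub>1 \<and> Y \<in> {f\<^sub>2, f\<^sub>1\<^sub>2, h\<^sub>1, h\<^sub>2} \<or>
     X = f\<^sub>2 \<and> Y \<in> {f\<^sub>1\<^sub>2, h\<^sub>1, h\<^sub>2} \<or> X = f\<^sub>1\<^sub>2 \<and> Y \<in> {h\<^sub>1, h\<^sub>2} \<or> X = h\<^sub>1 \<and> Y \<in> {h\<^sub>2}"

lemma bracket_compatible_pairs:
  assumes "generator_pair X Y"
  shows "bracket_compatible \<mu>\<^sub>1 \<mu>\<^sub>2 X Y (u_basis k l m)"
proof -
  consider "m = 0" | "m = 1" | n where "m = Suc (Suc n)"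
    by (metis One_nat_def not0_implies_Suc)
  then show ?thesis
    using assms unfolding bracket_compatible_def
    by cases
      (elim disjE conjE insertE emptyE;
        simp only: lie_bracket_generators M_act_generators M_act_matrix_linear M_act_zero_matrix
          M_act_add M_act_diff M_act_scale;
        rule poly_mapping_eqI; simp add: lookup_add lookup_minus algebra_simps)+
qed

lemma lie_bracket_laws:
  "lie_bracket X X = 0" "lie_bracket Y X = mat_scale (-1) (lie_bracket X Y)"
  "lie_bracket (X + X') Y = lie_bracket X Y + lie_bracket X' Y"
  "lie_bracket X (Y + Y') = lie_bracket X Y + lie_bracket X Y'"
  "lie_bracket (mat_scale c X) Y = mat_scale c (lie_bracket X Y)"
  "lie_bracket X (mat_scale c Y) = mat_scale c (lie_bracket X Y)"
  by (simp_all add: lie_bracket_def mat_scale_def vec_eq_iff matrix_matrix_mult_def sum_3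
      algebra_simps)

lemma bracket_compatible_swap:
  "bracket_compatible \<mu>\<^sub>1 \<mu>\<^sub>2 X Y v \<Longrightarrow> bracket_compatible \<mu>\<^sub>1 \<mu>\<^sub>2 Y X v"
  unfolding bracket_compatible_def lie_bracket_laws(2)[of Y X] M_act_matrix_linear
  by (rule poly_mapping_eqI) (simp add: lookup_minus)

lemma bracket_compatible_self: "bracket_compatible \<mu>\<^sub>1 \<mu>\<^sub>2 X X v"
  by (simp add: bracket_compatible_def lie_bracket_laws(1) M_act_zero_matrix)

lemma bracket_compatible_generators:
  assumes "X \<in> sl3_generators" "Y \<in> sl3_generators"
  shows "bracket_compatible \<mu>\<^sub>1 \<mu>\<^sub>2 X Y (u_basis k l m)"
proof -
  have "X = Y \<or> generator_pair X Y \<or> generator_pair Y X"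
    using assms unfolding sl3_generators_def insert_iff empty_iff by argo
  then show ?thesis
  proof (rule disjE)
    assume "X = Y"
    then show ?thesis by (simp only: bracket_compatible_self)
  next
    assume "generator_pair X Y \<or> generator_pair Y X"
    then show ?thesis
    proof (rule disjE)
      assume "generator_pair X Y"
      then show ?thesis by (rule bracket_compatible_pairs)
    next
      assume "generator_pair Y X"
      then show ?thesis by (rule bracket_compatible_pairs[THEN bracket_compatible_swap])
    qed
  qed
qed

lemma bracket_compatible_linear:
  "bracket_compatible \<mu>\<^sub>1 \<mu>\<^sub>2 X Y v \<Longrightarrow> bracket_compatible \<mu>\<^sub>1 \<mu>\<^sub>2 X' Y v \<Longrightarrow>
    bracket_compatible \<mu>\<^sub>1 \<mu>\<^sub>2 (X + X') Y v"
  "bracket_compatible \<mu>\<^sub>1 \<mu>\<^sub>2 X Y v \<Longrightarrow> bracket_compatible \<mu>\<^sub>1 \<mu>\<^sub>2 (mat_scale c X) Y v"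
  by (simp_all add: bracket_compatible_def lie_bracket_laws(3-6) M_act_matrix_linear M_act_add
      M_act_scale M_scale_laws)

lemma bracket_compatible_u_basis:
  assumes "X \<in> sl3" "Y \<in> sl3"
  shows "bracket_compatible \<mu>\<^sub>1 \<mu>\<^sub>2 X Y (u_basis k l m)"
proof -
  let ?P = "\<lambda>X Y. bracket_compatible \<mu>\<^sub>1 \<mu>\<^sub>2 X Y (u_basis k l m)"
  have gen: "?P Y X" if "Y \<in> sl3_generators" for Y
  proof (rule bracket_compatible_swap, rule sl3_generator_induct[where P = "\<lambda>X. ?P X Y"])
    show "X \<in> sl3" by (rule assms(1))
    show "?P Z Y" if "Z \<in> sl3_generators" for Z
      by (rule bracket_compatible_generators) fact+
  qed (erule (1) bracket_compatible_linear | erule bracket_compatible_linear)+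
  have "?P Y X"
  proof (rule sl3_generator_induct[where P = "\<lambda>Y. ?P Y X"])
    show "Y \<in> sl3" by (rule assms(2))
    show "?P Z X" if "Z \<in> sl3_generators" for Z
      using that by (rule gen)
  qed (erule (1) bracket_compatible_linear | erule bracket_compatible_linear)+
  then show ?thesis
    by (rule bracket_compatible_swap)
qed

lemma M_space_expansion:
  "v = (\<Sum>(k, l, m)\<in>Poly_Mapping.keys v. Poly_Mapping.lookup v (k, l, m) \<cdot> u_basis k l m)"
proof (rule poly_mapping_eqI)
  fix b
  have *: "Poly_Mapping.lookup (case c of (k, l, m) \<Rightarrow> Poly_Mapping.lookup v (k, l, m) \<cdot> u_basis k l m) b
      = (if c = b then Poly_Mapping.lookup v b else 0)" for c
    by (auto simp: u_basis_def lookup_single when_def split: prod.split)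
  show "Poly_Mapping.lookup v b = Poly_Mapping.lookup
      (\<Sum>(k, l, m)\<in>Poly_Mapping.keys v. Poly_Mapping.lookup v (k, l, m) \<cdot> u_basis k l m) b"
    by (simp add: lookup_sum * not_in_keys_iff_lookup_eq_zero)
qed

lemma bracket_compatible:
  assumes "X \<in> sl3" "Y \<in> sl3"
  shows "bracket_compatible \<mu>\<^sub>1 \<mu>\<^sub>2 X Y v"
proof -
  have add: "bracket_compatible \<mu>\<^sub>1 \<mu>\<^sub>2 X Y v \<Longrightarrow> bracket_compatible \<mu>\<^sub>1 \<mu>\<^sub>2 X Y w \<Longrightarrow>
      bracket_compatible \<mu>\<^sub>1 \<mu>\<^sub>2 X Y (v + w)" for v w
    by (simp add: bracket_compatible_def M_act_add)
  have scale: "bracket_compatible \<mu>\<^sub>1 \<mu>\<^sub>2 X Y v \<Longrightarrow> bracket_compatible \<mu>\<^sub>1 \<mu>\<^sub>2 X Y (c \<cdot> v)" for c v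
    by (simp add: bracket_compatible_def M_act_scale M_scale_laws)
  have sum: "finite S \<Longrightarrow> (\<And>b. b \<in> S \<Longrightarrow> bracket_compatible \<mu>\<^sub>1 \<mu>\<^sub>2 X Y (g b)) \<Longrightarrow>
      bracket_compatible \<mu>\<^sub>1 \<mu>\<^sub>2 X Y (sum g S)" for S and g :: "int \<times> int \<times> nat \<Rightarrow> M_space"
    by (induct S rule: finite_induct)
      (auto intro: add, simp add: bracket_compatible_def M_act_def)
  show ?thesis
    by (subst M_space_expansion)
      (auto intro!: sum scale bracket_compatible_u_basis assms)
qed

theorem M_rep_sl3_module: "sl3_module (M_rep \<mu>\<^sub>1 \<mu>\<^sub>2)"
proof -
  interpret vector_space M_scale by (rule M_vector_space)
  show ?thesis
    using bracket_compatible[unfolded bracket_compatible_def]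
    by (simp add: sl3_module_def M_rep_def M_vector_space M_act_add M_act_scale
        M_act_matrix_linear)
qed

end

theory Submission
  imports Defs
begin

text \<open>
  An isomorphism \<open>\<phi>\<close> onto the dual is the same as a nondegenerate form \<open>(v, x) \<mapsto> \<phi> v x\<close> that is
  contravariant, i.e. \<open>(X v, x) = - (v, \<tau>(X) x)\<close>.  The eigenbasis is obtained as
  \<open>w k l m = f\<^sub>1\<^sub>2\<^sup>m u k l 0\<close> up to normalisation, so commuting \<open>f\<^sub>1\<^sub>2\<close> past \<open>X\<close> gives the action on it by
  induction on \<open>m\<close>.  A contravariant form is diagonal in this basis, and with \<open>K = k - \<mu>\<^sub>1\<close>,
  \<open>L = l - \<mu>\<^sub>2\<close>, \<open>s = K + L\<close> contravariance becomes a system of recurrences for the diagonal entries,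
  such as \<open>K (K - 1) (s + m) c (k + 1) l m = (K + 1) s (s - 1) c k l m\<close>.  If \<open>\<mu>\<^sub>1\<close> and \<open>\<mu>\<^sub>2\<close> are not
  integral it is solved by a product of Gamma factors without zeros or poles.  If \<open>\<mu>\<^sub>1\<close> is integral,
  take \<open>K = 0\<close>: then \<open>e\<^sub>1 u = 0\<close> for \<open>u = u k l 0\<close>, whereas \<open>u\<close> occurs in \<open>f\<^sub>1 u (k - 1) l 0\<close>, so
  \<open>(u, u) = 0\<close> and \<open>u\<close> lies in the radical; likewise for \<open>\<mu>\<^sub>2\<close>, with \<open>e\<^sub>2\<close> and \<open>f\<^sub>2\<close>.
\<close>

section \<open>Preliminaries: linear maps on finitely supported functions\<close>

lemma generators_in_sl3:
  "e\<^sub>1 \<in> sl3" "e\<^sub>2 \<in> sl3" "e\<^sub>1\<^sub>2 \<in> sl3" "f\<^sub>1 \<in> sl3" "f\<^sub>2 \<in> sl3" "f\<^sub>1\<^sub>2 \<in> sl3" "h\<^sub>1 \<in> sl3" "h\<^sub>2 \<in> sl3"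
  by (simp_all add: sl3_def trace_def sum_3 sl3_generator_defs mat_unit_def)

lemma vector_space_functional_scale: "vector_space functional_scale"
  by unfold_locales (auto simp: functional_scale_def fun_eq_iff algebra_simps)

lemma sum_apply: "(\<Sum>b\<in>S. f b) x = (\<Sum>b\<in>S. f b x)"
  by (induction S rule: infinite_finite_induct) auto

lemma vector_space_times: "vector_space ((*) :: complex \<Rightarrow> complex \<Rightarrow> complex)"
  by unfold_locales (auto simp: algebra_simps)

definition linear_extension ::
    "(complex \<Rightarrow> 'b \<Rightarrow> 'b) \<Rightarrow> (int \<times> int \<times> nat \<Rightarrow> 'b) \<Rightarrow> M_space \<Rightarrow> 'b::ab_group_add" where
  "linear_extension s g v = (\<Sum>b\<in>Poly_Mapping.keys v. s (Poly_Mapping.lookup v b) (g b))"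

lemma linear_linear_extension:
  assumes "vector_space s"
  shows "Vector_Spaces.linear M_scale s (linear_extension s g)"
proof -
  interpret M: vector_space M_scale by (rule M_vector_space)
  interpret V: vector_space s by fact
  have superset: "linear_extension s g v = (\<Sum>b\<in>S. s (Poly_Mapping.lookup v b) (g b))"
    if "finite S" "Poly_Mapping.keys v \<subseteq> S" for S and v :: M_space
    unfolding linear_extension_def
    by (rule sum.mono_neutral_left) (use that in \<open>auto simp: not_in_keys_iff_lookup_eq_zero\<close>)
  show ?thesis
  proof
    fix v w :: M_space
    let ?S = "Poly_Mapping.keys v \<union> Poly_Mapping.keys w"
    have "linear_extension s g (v + w) = (\<Sum>b\<in>?S. s (Poly_Mapping.lookup (v + w) b) (g b))"
      by (rule superset) (use Poly_Mapping.keys_add[of v w] in auto)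
    also have "\<dots> = linear_extension s g v + linear_extension s g w"
      by (subst (1 2) superset[of ?S])
        (auto simp: lookup_add V.scale_left_distrib sum.distrib)
    finally show "linear_extension s g (v + w) = linear_extension s g v + linear_extension s g w" .
  next
    fix c and v :: M_space
    have "linear_extension s g (c \<cdot> v)
        = (\<Sum>b\<in>Poly_Mapping.keys v. s (Poly_Mapping.lookup (c \<cdot> v) b) (g b))"
      by (rule superset) (auto simp: in_keys_iff)
    then show "linear_extension s g (c \<cdot> v) = s c (linear_extension s g v)"
      by (simp add: linear_extension_def V.scale_sum_right)
  qed
qed

lemma linear_extension_u_basis:
  assumes "vector_space s"
  shows "linear_extension s g (u_basis k l m) = g (k, l, m)"
proof -
  interpret V: vector_space s by fact
  show ?thesis by (simp add: linear_extension_def u_basis_def)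
qed

lemma linear_M_act: "Vector_Spaces.linear M_scale M_scale (M_act \<mu>\<^sub>1 \<mu>\<^sub>2 X)"
  by (simp add: Vector_Spaces.linear_iff M_vector_space M_act_add M_act_scale)

lemma M_act_zero: "M_act \<mu>\<^sub>1 \<mu>\<^sub>2 X 0 = 0"
  by (simp add: M_act_def)

lemma M_act_uminus_matrix: "M_act \<mu>\<^sub>1 \<mu>\<^sub>2 (- X) v = - M_act \<mu>\<^sub>1 \<mu>\<^sub>2 X v"
  using M_act_matrix_linear(1)[of \<mu>\<^sub>1 \<mu>\<^sub>2 X "- X" v]
  by (simp add: M_act_zero_matrix eq_neg_iff_add_eq_0 add.commute)

lemma linear_eq_on_u_basis:
  assumes "Vector_Spaces.linear M_scale s f" "Vector_Spaces.linear M_scale s g"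
    and "\<And>k l m. f (u_basis k l m) = g (u_basis k l m)"
  shows "f v = g v"
proof -
  interpret f: Vector_Spaces.linear M_scale s f by fact
  interpret g: Vector_Spaces.linear M_scale s g by fact
  show ?thesis
    by (subst (1 2) M_space_expansion)
      (simp add: f.sum g.sum f.scale g.scale assms(3) case_prod_unfold)
qed

section \<open>The eigenbasis and the action of the generators on it\<close>

locale M_nonintegral_sum =
  fixes \<mu>\<^sub>1 \<mu>\<^sub>2 :: complex
  assumes nonintegral: "\<mu>\<^sub>1 + \<mu>\<^sub>2 \<notin> \<int>"
begin

abbreviation act :: "complex^3^3 \<Rightarrow> M_space \<Rightarrow> M_space" where
  "act \<equiv> M_act \<mu>\<^sub>1 \<mu>\<^sub>2"

text \<open>\<open>kb k\<close> and \<open>lb l\<close> are the paper's \<open>k\<close> and \<open>l\<close> with a bar.\<close>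

definition kb :: "int \<Rightarrow> complex" where "kb k = of_int k - \<mu>\<^sub>1"
definition lb :: "int \<Rightarrow> complex" where "lb l = of_int l - \<mu>\<^sub>2"
definition sb :: "int \<Rightarrow> int \<Rightarrow> complex" where "sb k l = kb k + lb l"

lemma bar_shift:
  "kb (k + 1) = kb k + 1" "kb (k - 1) = kb k - 1" "lb (l + 1) = lb l + 1" "lb (l - 1) = lb l - 1"
  "sb (k + 1) l = sb k l + 1" "sb (k - 1) l = sb k l - 1"
  "sb k (l + 1) = sb k l + 1" "sb k (l - 1) = sb k l - 1"
  "kb (1 + k) = kb k + 1" "lb (1 + l) = lb l + 1"
  "sb (1 + k) l = sb k l + 1" "sb k (1 + l) = sb k l + 1"
  by (simp_all add: kb_def lb_def sb_def)

lemma sb_add_int_nonzero: "sb k l + of_int j \<noteq> 0"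
proof
  assume "sb k l + of_int j = 0"
  then have "\<mu>\<^sub>1 + \<mu>\<^sub>2 = of_int (k + l + j)"
    by (simp add: sb_def kb_def lb_def algebra_simps add_eq_0_iff)
  then show False using nonintegral by (metis Ints_of_int)
qed

text \<open>The same fact in several shapes, since simp recognises a nonzero denominator only in the
  form that \<open>bar_shift\<close> and the casts of \<open>Suc\<close> leave behind.\<close>

lemma sb_nonzero:
  "sb k l \<noteq> 0" "sb k l - 1 \<noteq> 0" "sb k l - 2 \<noteq> 0" "sb k l + 1 \<noteq> 0"
  "sb k l + of_nat m \<noteq> 0" "sb k l + of_nat m + 1 \<noteq> 0" "sb k l + 1 + of_nat m \<noteq> 0"
  "sb k l - 1 + of_nat m \<noteq> 0" "sb k l + (1 + of_nat m) \<noteq> 0" "1 + (sb k l + of_nat m) \<noteq> 0"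
  "1 + (of_nat m + sb k l) \<noteq> 0" "sb k l \<noteq> 1" "sb k l \<noteq> 2"
  using sb_add_int_nonzero[of k l 0] sb_add_int_nonzero[of k l "-1"]
    sb_add_int_nonzero[of k l "-2"] sb_add_int_nonzero[of k l 1]
    sb_add_int_nonzero[of k l "int m"] sb_add_int_nonzero[of k l "int m + 1"]
    sb_add_int_nonzero[of k l "int m - 1"]
  by (simp_all add: algebra_simps)

lemmas u_act = M_act_generators[of \<mu>\<^sub>1 \<mu>\<^sub>2, folded kb_def lb_def]

text \<open>The division keeps the coefficient of \<open>u_basis k l m\<close> in
  \<open>w k l m\<close> equal to 1. The recursive form replaces an explicit binomial sum, so that
  only commutators with \<open>f\<^sub>1\<^sub>2\<close> are needed.\<close>

fun w :: "int \<Rightarrow> int \<Rightarrow> nat \<Rightarrow> M_space" where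
  "w k l 0 = u_basis k l 0"
| "w k l (Suc m) = (1 / (sb k l + of_nat m)) \<cdot> act f\<^sub>1\<^sub>2 (w k l m)"

lemma f12_w: "act f\<^sub>1\<^sub>2 (w k l m) = (sb k l + of_nat m) \<cdot> w k l (Suc m)"
  by (simp add: w.simps M_scale_laws sb_nonzero)

lemma act_f12_commute:
  assumes "X \<in> sl3"
  shows "act X (act f\<^sub>1\<^sub>2 v) = act f\<^sub>1\<^sub>2 (act X v) + act (lie_bracket X f\<^sub>1\<^sub>2) v"
  using bracket_compatible[OF assms generators_in_sl3(6), of \<mu>\<^sub>1 \<mu>\<^sub>2 v]
  by (simp add: bracket_compatible_def)

lemma act_w_Suc:
  assumes "X \<in> sl3"
  shows "act X (w k l (Suc m)) = (1 / (sb k l + of_nat m)) \<cdot>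
    (act f\<^sub>1\<^sub>2 (act X (w k l m)) + act (lie_bracket X f\<^sub>1\<^sub>2) (w k l m))"
  by (simp add: w.simps M_act_scale act_f12_commute[OF assms])

declare w.simps [simp del]

text \<open>These brackets dictate the order of what follows: \<open>f\<^sub>1\<close> and
  \<open>f\<^sub>2\<close> commute with \<open>f\<^sub>1\<^sub>2\<close>, the Cartan elements
  rescale it, and the positive root vectors lead back to \<open>f\<^sub>2\<close>,
  \<open>f\<^sub>1\<close> and \<open>h\<^sub>1 + h\<^sub>2\<close>.\<close>

lemma bracket_f12:
  "lie_bracket e\<^sub>1 f\<^sub>1\<^sub>2 = mat_scale (-1) f\<^sub>2" "lie_bracket e\<^sub>2 f\<^sub>1\<^sub>2 = f\<^sub>1"
  "lie_bracket e\<^sub>1\<^sub>2 f\<^sub>1\<^sub>2 = h\<^sub>1 + h\<^sub>2" "lie_bracket f\<^sub>1 f\<^sub>1\<^sub>2 = 0" "lie_bracket f\<^sub>2 f\<^sub>1\<^sub>2 = 0"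
  "lie_bracket h\<^sub>1 f\<^sub>1\<^sub>2 = mat_scale (-1) f\<^sub>1\<^sub>2" "lie_bracket h\<^sub>2 f\<^sub>1\<^sub>2 = mat_scale (-1) f\<^sub>1\<^sub>2"
  by (simp_all only: lie_bracket_generators lie_bracket_laws(2)[of h\<^sub>1] lie_bracket_laws(2)[of h\<^sub>2])

text \<open>Serves the base cases for \<open>f\<^sub>1\<close> and \<open>f\<^sub>2\<close>, which
  send \<open>u_basis k l 0\<close> to vectors with last index at most 1.\<close>

lemma w_one: "u_basis k l (Suc 0) = w k l (Suc 0) - (lb l / sb k l) \<cdot> u_basis (k + 1) (l + 1) 0"
  by (rule poly_mapping_eqI)
    (simp add: w.simps u_act lookup_add lookup_minus sb_def[symmetric] sb_nonzero field_simps)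

text \<open>Left: the coefficients of \<open>f2_w\<close> and \<open>f1_w\<close> at
  \<open>m = 0\<close>. Right: what the action on \<open>u_basis k l 0\<close> yields after
  \<open>w_one\<close>.\<close>

lemma reduced_coefficient:
  "lb l * (lb l - 1) * sb k l / (sb k l * (sb k l - 1)) = lb l - kb k * lb l / (sb k l - 1)"
  "kb k * (kb k - 1) * sb k l / (sb k l * (sb k l - 1))
    = kb k - lb l + lb l * (lb l - 1) / (sb k l - 1)"
proof -
  have "kb k = sb k l - lb l" by (simp add: sb_def)
  then show
    "lb l * (lb l - 1) * sb k l / (sb k l * (sb k l - 1)) = lb l - kb k * lb l / (sb k l - 1)"
    "kb k * (kb k - 1) * sb k l / (sb k l * (sb k l - 1))
      = kb k - lb l + lb l * (lb l - 1) / (sb k l - 1)"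
    by (simp_all add: sb_nonzero divide_simps) (simp_all add: algebra_simps)
qed

text \<open>Since \<open>f\<^sub>2\<close> commutes with \<open>f\<^sub>1\<^sub>2\<close>, the case
  \<open>m = 0\<close> is only rescaled: the second term picks up (s + m) / s from the different
  normalisation of \<open>w k (l + 1) m\<close>, the first term nothing.\<close>

lemma f2_w: "act f\<^sub>2 (w k l m) = kb k \<cdot> w (k - 1) l (Suc m)
   + (lb l * (lb l - 1) * (sb k l + of_nat m) / (sb k l * (sb k l - 1))) \<cdot> w k (l + 1) m"
proof (induction m)
  case 0
  show ?case
    unfolding of_nat_0 add_0_right reduced_coefficient
    by (intro poly_mapping_eqI)
      (simp add: w.simps(1) w_one u_act bar_shift lookup_add lookup_minus algebra_simps)
next
  case (Suc m)
  show ?case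
    by (intro poly_mapping_eqI)
     (simp add: act_w_Suc generators_in_sl3 Suc.IH bracket_f12 M_act_zero_matrix M_act_add M_act_scale
       f12_w lookup_add bar_shift sb_nonzero divide_simps; simp add: algebra_simps)
qed

lemma f1_w: "act f\<^sub>1 (w k l m) = (- lb l) \<cdot> w k (l - 1) (Suc m)
   + (kb k * (kb k - 1) * (sb k l + of_nat m) / (sb k l * (sb k l - 1))) \<cdot> w (k + 1) l m"
proof (induction m)
  case 0
  show ?case
    unfolding of_nat_0 add_0_right reduced_coefficient
    by (intro poly_mapping_eqI)
      (simp add: w.simps(1) w_one u_act bar_shift lookup_add lookup_minus algebra_simps)
next
  case (Suc m)
  show ?case
    by (intro poly_mapping_eqI)
     (simp add: act_w_Suc generators_in_sl3 Suc.IH bracket_f12 M_act_zero_matrix M_act_add M_act_scale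
       f12_w lookup_add bar_shift sb_nonzero divide_simps; simp add: algebra_simps)
qed

lemma h1_w: "act h\<^sub>1 (w k l m) = (- (2 * (kb k + of_nat m) - (lb l + of_nat m))) \<cdot> w k l m"
proof (induction m)
  case (Suc m)
  show ?case
    by (intro poly_mapping_eqI)
     (simp add: act_w_Suc generators_in_sl3 Suc.IH bracket_f12 M_act_matrix_linear M_act_scale
       f12_w lookup_add sb_nonzero divide_simps; simp add: algebra_simps)
qed (simp add: w.simps(1) u_act)

lemma h2_w: "act h\<^sub>2 (w k l m) = (- (2 * (lb l + of_nat m) - (kb k + of_nat m))) \<cdot> w k l m"
proof (induction m)
  case (Suc m)
  show ?case
    by (intro poly_mapping_eqI)
     (simp add: act_w_Suc generators_in_sl3 Suc.IH bracket_f12 M_act_matrix_linear M_act_scale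
       f12_w lookup_add sb_nonzero divide_simps; simp add: algebra_simps)
qed (simp add: w.simps(1) u_act)

text \<open>An sl2 computation: \<open>h\<^sub>1 + h\<^sub>2\<close> has eigenvalue -(s + 2j) on
  \<open>w k l j\<close>, and the sum over j < m is -m (s + m - 1), whose last factor is cancelled
  by the normalisation.\<close>

lemma e12_w: "act e\<^sub>1\<^sub>2 (w k l m) = (- of_nat m) \<cdot> w k l (m - 1)"
proof (induction m)
  case (Suc m)
  then show ?case
    \<comment> \<open>The split resolves the truncated \<open>m - 1\<close> in the induction
      hypothesis.\<close>
    by (cases m; intro poly_mapping_eqI)
     (simp_all add: act_w_Suc generators_in_sl3 bracket_f12 M_act_matrix_linear M_act_scale
       h1_w h2_w f12_w lookup_add sb_nonzero divide_simps M_act_zero M_scale_laws(5);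
       (simp add: algebra_simps)?; (simp add: sb_def algebra_simps)?)+
qed (simp add: w.simps(1) u_act)

lemma e1_w: "act e\<^sub>1 (w k l m) = (- kb k) \<cdot> w (k - 1) l m
   - (lb l * (lb l - 1) / (sb k l * (sb k l - 1)) * of_nat m) \<cdot> w k (l + 1) (m - 1)"
proof (induction m)
  case (Suc m)
  then show ?case
    by (cases m; intro poly_mapping_eqI)
     (simp_all add: act_w_Suc generators_in_sl3 bracket_f12 M_act_matrix_linear M_act_scale
       M_act_diff f12_w f2_w lookup_add lookup_minus bar_shift sb_nonzero divide_simps
       M_act_zero M_scale_laws(5);
       simp add: algebra_simps)+
qed (simp add: w.simps(1) u_act M_scale_laws(5))

lemma e2_w: "act e\<^sub>2 (w k l m) = (- lb l) \<cdot> w k (l - 1) m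
   + (kb k * (kb k - 1) / (sb k l * (sb k l - 1)) * of_nat m) \<cdot> w (k + 1) l (m - 1)"
proof (induction m)
  case (Suc m)
  then show ?case
    by (cases m; intro poly_mapping_eqI)
     (simp_all add: act_w_Suc generators_in_sl3 bracket_f12 M_act_matrix_linear M_act_scale
       M_act_add f12_w f1_w lookup_add bar_shift sb_nonzero divide_simps
       M_act_zero M_scale_laws(5);
       simp add: algebra_simps)+
qed (simp add: w.simps(1) u_act M_scale_laws(5))

lemma f12_e12_w:
  "act f\<^sub>1\<^sub>2 (act e\<^sub>1\<^sub>2 (w k l m)) = (- of_nat m * (sb k l + of_nat m - 1)) \<cdot> w k l m"
  by (cases m) (simp_all add: e12_w M_act_scale f12_w M_act_zero M_scale_laws(3,5) algebra_simps)

section \<open>Coordinates with respect to the eigenbasis\<close>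

text \<open>The coordinates with respect to \<open>w\<close> are constructed from the requirement that they intertwine
  \<open>f\<^sub>1\<^sub>2\<close> with its diagonal shift on the \<open>w\<close>; solving the formula for \<open>f\<^sub>1\<^sub>2 u k l m\<close> for its leading
  term turns this into a recursion on \<open>m\<close>.\<close>

definition shift_f12 :: "M_space \<Rightarrow> M_space" where
  "shift_f12 = linear_extension M_scale (\<lambda>(k, l, m). (sb k l + of_nat m) \<cdot> u_basis k l (Suc m))"

lemmas linear_shift_f12 =
  linear_linear_extension[OF M_vector_space, of "\<lambda>(k, l, m). (sb k l + of_nat m) \<cdot> u_basis k l (Suc m)",
    folded shift_f12_def]

lemma shift_f12_u: "shift_f12 (u_basis k l m) = (sb k l + of_nat m) \<cdot> u_basis k l (Suc m)"
  by (simp add: shift_f12_def linear_extension_u_basis[OF M_vector_space])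

fun u_coords :: "int \<Rightarrow> int \<Rightarrow> nat \<Rightarrow> M_space" where
  "u_coords k l 0 = u_basis k l 0"
| "u_coords k l (Suc m) = (1 / (sb k l + of_nat m)) \<cdot>
     (shift_f12 (u_coords k l m) - lb l \<cdot> u_coords (k + 1) (l + 1) m)"

definition coords :: "M_space \<Rightarrow> M_space" where
  "coords = linear_extension M_scale (\<lambda>(k, l, m). u_coords k l m)"

lemmas linear_coords =
  linear_linear_extension[OF M_vector_space, of "\<lambda>(k, l, m). u_coords k l m", folded coords_def]

lemma coords_u: "coords (u_basis k l m) = u_coords k l m"
  by (simp add: coords_def linear_extension_u_basis[OF M_vector_space])

lemma coords_f12: "coords (act f\<^sub>1\<^sub>2 v) = shift_f12 (coords v)"
proof -
  interpret S: Vector_Spaces.linear M_scale M_scale coords by (rule linear_coords)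
  have "coords (act f\<^sub>1\<^sub>2 (u_basis k l m)) = shift_f12 (coords (u_basis k l m))" for k l m
    by (simp add: w.simps(1) u_act coords_u S.add S.scale M_scale_laws(3,4) sb_nonzero sb_def[symmetric])
  from linear_eq_on_u_basis[OF
    Vector_Spaces.linear_compose[OF linear_M_act linear_coords, of \<mu>\<^sub>1 \<mu>\<^sub>2 "f\<^sub>1\<^sub>2"]
    Vector_Spaces.linear_compose[OF linear_coords linear_shift_f12], unfolded o_def, OF this]
  show ?thesis .
qed

text \<open>Gives linear independence of the \<open>w k l m\<close>;
  \<open>from_coords_coords\<close> gives that they span.\<close>

lemma coords_w: "coords (w k l m) = u_basis k l m"
proof (induction m)
  case (Suc m)
  interpret S: Vector_Spaces.linear M_scale M_scale coords by (rule linear_coords)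
  show ?case
    by (simp add: w.simps S.scale coords_f12 Suc.IH shift_f12_u M_scale_laws(3,4) sb_nonzero)
qed (simp add: w.simps(1) coords_u)

definition from_coords :: "M_space \<Rightarrow> M_space" where
  "from_coords = linear_extension M_scale (\<lambda>(k, l, m). w k l m)"

lemmas linear_from_coords =
  linear_linear_extension[OF M_vector_space, of "\<lambda>(k, l, m). w k l m", folded from_coords_def]

lemma from_coords_u: "from_coords (u_basis k l m) = w k l m"
  by (simp add: from_coords_def linear_extension_u_basis[OF M_vector_space])

lemma from_coords_shift: "from_coords (shift_f12 v) = act f\<^sub>1\<^sub>2 (from_coords v)"
proof -
  interpret T: Vector_Spaces.linear M_scale M_scale from_coords by (rule linear_from_coords)
  have "from_coords (shift_f12 (u_basis k l m)) = act f\<^sub>1\<^sub>2 (from_coords (u_basis k l m))" for k l m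
    by (simp add: shift_f12_u from_coords_u f12_w T.scale)
  from linear_eq_on_u_basis[OF
    Vector_Spaces.linear_compose[OF linear_shift_f12 linear_from_coords]
    Vector_Spaces.linear_compose[OF linear_from_coords linear_M_act, of \<mu>\<^sub>1 \<mu>\<^sub>2 "f\<^sub>1\<^sub>2"],
    unfolded o_def, OF this]
  show ?thesis .
qed

lemma from_coords_coords: "from_coords (coords v) = v"
proof -
  interpret T: Vector_Spaces.linear M_scale M_scale from_coords by (rule linear_from_coords)
  \<comment> \<open>The indices \<open>k\<close> and \<open>l\<close> must vary, because the
    recursion for \<open>u_coords\<close> refers to \<open>k + 1\<close> and
    \<open>l + 1\<close>.\<close>
  have "from_coords (u_coords k l m) = u_basis k l m" for k l m
  proof (induction m arbitrary: k l)
    case 0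
    show ?case by (simp add: w.simps(1) from_coords_u)
  next
    case (Suc m)
    show ?case
      by (intro poly_mapping_eqI)
        (simp add: T.scale T.diff from_coords_shift Suc.IH u_act lookup_add lookup_minus
          sb_def[symmetric] sb_nonzero divide_simps)
  qed
  then have "from_coords (coords (u_basis k l m)) = u_basis k l m" for k l m
    by (simp add: coords_u)
  from linear_eq_on_u_basis[OF
    Vector_Spaces.linear_compose[OF linear_coords linear_from_coords]
    vector_space.linear_ident[OF M_vector_space], unfolded o_def, OF this]
  show ?thesis .
qed


lemma linear_eq_on_w:
  assumes "Vector_Spaces.linear M_scale s f" "Vector_Spaces.linear M_scale s g"
    and "\<And>k l m. f (w k l m) = g (w k l m)"
  shows "f v = g v"
proof -
  have "f (from_coords (coords v)) = g (from_coords (coords v))"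
    by (rule linear_eq_on_u_basis[OF
          Vector_Spaces.linear_compose[OF linear_from_coords assms(1)]
          Vector_Spaces.linear_compose[OF linear_from_coords assms(2)], unfolded o_def])
      (simp add: from_coords_u assms(3))
  then show ?thesis by (simp add: from_coords_coords)
qed

definition coord :: "int \<times> int \<times> nat \<Rightarrow> M_space \<Rightarrow> complex" where
  "coord b v = Poly_Mapping.lookup (coords v) b"

lemma linear_coord: "Vector_Spaces.linear M_scale (*) (coord b)"
proof -
  interpret S: Vector_Spaces.linear M_scale M_scale coords by (rule linear_coords)
  show ?thesis
    by (simp add: Vector_Spaces.linear_iff M_vector_space vector_space_times coord_def S.add S.scale
        lookup_add)
qed

lemma coord_add: "coord b (v + x) = coord b v + coord b x"
  and coord_scale: "coord b (c \<cdot> v) = c * coord b v"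
  using linear_coord[of b] by (auto simp: Vector_Spaces.linear_iff)

lemma coord_w: "coord b (w k l m) = (if b = (k, l, m) then 1 else 0)"
  by (simp add: coord_def coords_w u_basis_def lookup_single when_def eq_commute)

lemma coord_eq_0: "(\<And>b. coord b v = 0) \<Longrightarrow> v = 0"
proof -
  assume "\<And>b. coord b v = 0"
  then have "coords v = 0" by (intro poly_mapping_eqI) (simp add: coord_def)
  moreover have "from_coords 0 = 0" by (simp add: from_coords_def linear_extension_def)
  ultimately show "v = 0" using from_coords_coords[of v] by simp
qed

section \<open>Gamma factors solving the recurrences for the diagonal entries\<close>

text \<open>A solution of the recurrences \<open>coef_k\<close>, \<open>coef_l\<close>, \<open>coef_m\<close>.  It has no poles whatever the
  integrality of \<open>\<mu>\<^sub>1\<close> and \<open>\<mu>\<^sub>2\<close>, as \<open>rGamma\<close> is entire and \<open>sb k l\<close> is not an integer.\<close>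

definition coef :: "int \<times> int \<times> nat \<Rightarrow> complex" where
  "coef = (\<lambda>(k, l, m). kb k * lb l * Gamma (sb k l - 1) * rGamma (kb k - 1) * rGamma (lb l - 1) *
     ((- 1) ^ m * fact m * Gamma (sb k l) * rGamma (sb k l + of_nat m)))"

lemma Gamma_sb: "Gamma (sb k l + 1) = sb k l * Gamma (sb k l)"
proof (rule Gamma_plus1)
  show "sb k l \<notin> \<int>\<^sub>\<le>\<^sub>0"
    using sb_add_int_nonzero[of k l] by (metis nonpos_Ints_cases add.right_inverse of_int_minus)
qed

lemma Gamma_sb': "Gamma (sb k l) = (sb k l - 1) * Gamma (sb k l - 1)"
  using Gamma_sb[of "k - 1" l] by (simp add: bar_shift)

lemma rGamma_minus1: "rGamma (z - 1) = (z - 1) * rGamma (z :: complex)"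
  using rGamma_plus1[of "z - 1"] by simp

text \<open>This is contravariance of \<open>e\<^sub>1\<close> against \<open>f\<^sub>1\<close>,
  tested on \<open>w (k + 1) l m\<close> and \<open>w k l m\<close> and multiplied by s (s - 1).
  Likewise \<open>coef_l\<close> belongs to \<open>e\<^sub>2\<close> and \<open>coef_m\<close> to
  \<open>e\<^sub>1\<^sub>2\<close>.\<close>

lemma coef_k: "kb k * (kb k - 1) * (sb k l + of_nat m) * coef (k + 1, l, m)
    = (kb k + 1) * sb k l * (sb k l - 1) * coef (k, l, m)"
  using rGamma_plus1[of "sb k l + of_nat m", symmetric]
  by (simp add: coef_def bar_shift Gamma_sb Gamma_sb' rGamma_minus1[of "kb k"] ac_simps)

lemma coef_l: "lb l * (lb l - 1) * (sb k l + of_nat m) * coef (k, l + 1, m)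
    = (lb l + 1) * sb k l * (sb k l - 1) * coef (k, l, m)"
  using rGamma_plus1[of "sb k l + of_nat m", symmetric]
  by (simp add: coef_def bar_shift Gamma_sb Gamma_sb' rGamma_minus1[of "lb l"] ac_simps)

lemma coef_m: "(sb k l + of_nat m) * coef (k, l, Suc m) = - ((of_nat m + 1) * coef (k, l, m))"
  using rGamma_plus1[of "sb k l + of_nat m", symmetric]
  by (simp add: coef_def ac_simps)

text \<open>The condition from the remaining terms of \<open>e\<^sub>2\<close> and
  \<open>f\<^sub>2\<close>. It imposes nothing new: multiplied by the nonzero factor s - 1 + m, it
  follows from \<open>coef_k\<close> and \<open>coef_m\<close>.\<close>

lemma coef_k_m: "(of_nat m + 1) * (kb k - 1) * (kb k - 2) * coef (k, l, m)
    = - kb k * (sb k l - 1) * (sb k l - 2) * coef (k - 1, l, Suc m)"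
proof -
  have "(sb k l - 1 + of_nat m) * ((of_nat m + 1) * (kb k - 1) * (kb k - 2) * coef (k, l, m))
      = (of_nat m + 1) * (kb k * (sb k l - 1) * (sb k l - 2) * coef (k - 1, l, m))"
    using coef_k[of "k - 1" l m] by (simp add: bar_shift mult_ac)
  also have "\<dots> = - kb k * (sb k l - 1) * (sb k l - 2) * (- ((of_nat m + 1) * coef (k - 1, l, m)))"
    by simp
  also have "\<dots> = (sb k l - 1 + of_nat m) * (- kb k * (sb k l - 1) * (sb k l - 2) * coef (k - 1, l, Suc m))"
    unfolding coef_m[symmetric] by (simp add: bar_shift mult_ac)
  finally show ?thesis
    using sb_nonzero(8) by (metis mult_left_cancel)
qed

lemma coef_l_m: "(of_nat m + 1) * (lb l - 1) * (lb l - 2) * coef (k, l, m)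
    = - lb l * (sb k l - 1) * (sb k l - 2) * coef (k, l - 1, Suc m)"
proof -
  have "(sb k l - 1 + of_nat m) * ((of_nat m + 1) * (lb l - 1) * (lb l - 2) * coef (k, l, m))
      = (of_nat m + 1) * (lb l * (sb k l - 1) * (sb k l - 2) * coef (k, l - 1, m))"
    using coef_l[of "l - 1" k m] by (simp add: bar_shift mult_ac)
  also have "\<dots> = - lb l * (sb k l - 1) * (sb k l - 2) * (- ((of_nat m + 1) * coef (k, l - 1, m)))"
    by simp
  also have "\<dots> = (sb k l - 1 + of_nat m) * (- lb l * (sb k l - 1) * (sb k l - 2) * coef (k, l - 1, Suc m))"
    unfolding coef_m[symmetric] by (simp add: bar_shift mult_ac)
  finally show ?thesis
    using sb_nonzero(8) by (metis mult_left_cancel)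
qed

text \<open>Away from the nonpositive integers neither \<open>Gamma\<close> nor
  \<open>rGamma\<close> vanishes, and every argument is an integer translate of
  \<open>- \<mu>\<^sub>1\<close>, \<open>- \<mu>\<^sub>2\<close> or
  \<open>- (\<mu>\<^sub>1 + \<mu>\<^sub>2)\<close>.\<close>

lemma coef_nonzero:
  assumes "\<mu>\<^sub>1 \<notin> \<int>" "\<mu>\<^sub>2 \<notin> \<int>"
  shows "coef b \<noteq> 0"
proof -
  have aux: "z + of_int j \<notin> \<int>\<^sub>\<le>\<^sub>0" if "z \<notin> \<int>" for z :: complex and j
    using that nonpos_Ints_subset_Ints by (metis Ints_of_int Ints_diff add_diff_cancel_right' subsetD)
  obtain k l m where b: "b = (k, l, m)" by (cases b)
  have neg: "- \<mu>\<^sub>1 \<notin> \<int>" "- \<mu>\<^sub>2 \<notin> \<int>" "- (\<mu>\<^sub>1 + \<mu>\<^sub>2) \<notin> \<int>"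
    using assms nonintegral by (simp_all only: minus_in_Ints_iff) simp_all
  have "kb k \<noteq> 0" "lb l \<noteq> 0" using assms by (auto simp: kb_def lb_def)
  moreover have "kb k - 1 \<notin> \<int>\<^sub>\<le>\<^sub>0" "lb l - 1 \<notin> \<int>\<^sub>\<le>\<^sub>0" "sb k l - 1 \<notin> \<int>\<^sub>\<le>\<^sub>0" "sb k l \<notin> \<int>\<^sub>\<le>\<^sub>0"
    "sb k l + of_nat m \<notin> \<int>\<^sub>\<le>\<^sub>0"
    using aux[OF neg(1), of "k - 1"] aux[OF neg(2), of "l - 1"] aux[OF neg(3), of "k + l - 1"]
      aux[OF neg(3), of "k + l"] aux[OF neg(3), of "k + l + int m"]
    by (simp_all add: sb_def kb_def lb_def algebra_simps)
  ultimately show ?thesis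
    by (simp add: b coef_def Gamma_eq_zero_iff rGamma_eq_zero_iff)
qed

section \<open>The contravariant form\<close>

definition form :: "M_space \<Rightarrow> M_space \<Rightarrow> complex" where
  "form v x = (\<Sum>b\<in>Poly_Mapping.keys (coords v). coef b * coord b v * coord b x)"

lemma form_commute: "form v x = form x v"
proof -
  let ?S = "Poly_Mapping.keys (coords v) \<union> Poly_Mapping.keys (coords x)"
  have "form v x = (\<Sum>b\<in>?S. coef b * coord b v * coord b x)"
    unfolding form_def
    by (rule sum.mono_neutral_left) (auto simp: coord_def not_in_keys_iff_lookup_eq_zero)
  also have "\<dots> = (\<Sum>b\<in>?S. coef b * coord b x * coord b v)" by (simp add: mult_ac)
  also have "\<dots> = form x v"
    unfolding form_def
    by (rule sum.mono_neutral_right) (auto simp: coord_def not_in_keys_iff_lookup_eq_zero)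
  finally show ?thesis .
qed

lemma linear_form: "Vector_Spaces.linear M_scale (*) (form v)"
  by (simp add: Vector_Spaces.linear_iff M_vector_space vector_space_times form_def coord_add
      coord_scale sum.distrib sum_distrib_left algebra_simps)

lemma form_right: "form v (x + y) = form v x + form v y" "form v (c \<cdot> x) = c * form v x"
  "form v (x - y) = form v x - form v y"
proof -
  interpret Vector_Spaces.linear M_scale "(*)" "form v" by (rule linear_form)
  show "form v (x + y) = form v x + form v y" "form v (c \<cdot> x) = c * form v x"
    "form v (x - y) = form v x - form v y"
    by (rule add scale diff)+
qed

lemma form_left: "form (x + y) v = form x v + form y v" "form (c \<cdot> x) v = c * form x v"
  "form (x - y) v = form x v - form y v"
  by (simp_all add: form_commute[of _ v] form_right)

lemma form_w: "form v (w k l m) = coef (k, l, m) * coord (k, l, m) v"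
  by (simp add: form_def coord_w if_distrib[of "(*) _"] cong: if_cong)
    (simp add: coord_def not_in_keys_iff_lookup_eq_zero)

lemma form_w_w:
  "form (w k l m) (w k' l' m') = (if (k, l, m) = (k', l', m') then coef (k, l, m) else 0)"
  by (auto simp: form_w coord_w)

definition invariant :: "complex^3^3 \<Rightarrow> bool" where
  "invariant X \<longleftrightarrow> (\<forall>v x. form (act X v) x = - form v (act (tau X) x))"

lemma invariantI:
  assumes "\<And>k l m k' l' m'. form (act X (w k l m)) (w k' l' m')
    = - form (w k l m) (act (tau X) (w k' l' m'))"
  shows "invariant X"
proof -
  have lin: "Vector_Spaces.linear M_scale (*) (\<lambda>v. form (act X v) x)"
    "Vector_Spaces.linear M_scale (*) (\<lambda>v. - form v (act X x))"
    "Vector_Spaces.linear M_scale (*) (\<lambda>x. - form v (act X x))" for v x X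
    by (simp_all add: Vector_Spaces.linear_iff M_vector_space vector_space_times M_act_add M_act_scale
        form_left form_right)
  have "form (act X (w k l m)) x = - form (w k l m) (act (tau X) x)" for k l m x
    by (rule linear_eq_on_w[OF linear_form lin(3)]) (rule assms)
  then have "form (act X v) x = - form v (act (tau X) x)" for v x
    by (rule linear_eq_on_w[OF lin(1,2)])
  then show ?thesis by (simp add: invariant_def)
qed

lemma form_uminus: "form v (- x) = - form v x"
  using form_right(3)[of v 0 x] form_right(2)[of v 0 0] by (simp add: M_scale_laws)

lemma invariant_h1: "invariant h\<^sub>1" and invariant_h2: "invariant h\<^sub>2"
  by (rule invariantI, simp add: tau_generators M_act_uminus_matrix form_uminus
      h1_w h2_w form_left form_right form_w_w)+

lemma invariant_e12: "invariant e\<^sub>1\<^sub>2"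
proof (rule invariantI)
  fix k l m k' l' m'
  show "form (act e\<^sub>1\<^sub>2 (w k l m)) (w k' l' m') = - form (w k l m) (act (tau e\<^sub>1\<^sub>2) (w k' l' m'))"
    \<comment> \<open>Both sides vanish unless the first index triple is
      \<open>(k', l', Suc m')\<close>, and there the claim is \<open>coef_m\<close>.\<close>
    using coef_m[of k' l' m']
    by (cases m) (auto simp: algebra_simps tau_generators M_act_uminus_matrix form_uminus
        e12_w f12_w form_left form_right form_w_w)
qed

lemma invariant_e1: "invariant e\<^sub>1"
proof (rule invariantI)
  fix k l m k' l' m'
  show "form (act e\<^sub>1 (w k l m)) (w k' l' m') = - form (w k l m) (act (tau e\<^sub>1) (w k' l' m'))"
  proof -
    \<comment> \<open>Each term of \<open>e1_w\<close> has a partner in \<open>f1_w\<close>: the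
      terms lowering and raising \<open>k\<close> meet in the first case, those changing
      \<open>l\<close> and \<open>m\<close> in the second. Otherwise both sides are 0.\<close>
    consider "k = k' + 1" "l = l'" "m = m'" | "k' = k" "l' = l + 1" "m = Suc m'"
      | "(k, l, m) \<noteq> (k' + 1, l', m')" "(k, l, m) \<noteq> (k', l' - 1, Suc m')" by force
    then show ?thesis
    proof cases
      case 1
      then show ?thesis using coef_k[of k' l' m']
        by (simp add: tau_generators e1_w f1_w form_left form_right form_w_w
            bar_shift sb_nonzero field_simps)
    next
      case 2
      then show ?thesis using coef_l_m[of m' "l + 1" k]
        by (simp add: tau_generators e1_w f1_w form_left form_right form_w_w
            bar_shift sb_nonzero field_simps)
    next
      case 3
      then show ?thesis
        by (cases m) (auto simp: tau_generators e1_w f1_w form_left form_right form_w_w)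
    qed
  qed
qed

lemma invariant_e2: "invariant e\<^sub>2"
proof (rule invariantI)
  fix k l m k' l' m'
  show "form (act e\<^sub>2 (w k l m)) (w k' l' m') = - form (w k l m) (act (tau e\<^sub>2) (w k' l' m'))"
  proof -
    consider "k = k'" "l = l' + 1" "m = m'" | "k' = k + 1" "l' = l" "m = Suc m'"
      | "(k, l, m) \<noteq> (k', l' + 1, m')" "(k, l, m) \<noteq> (k' - 1, l', Suc m')" by force
    then show ?thesis
    proof cases
      case 1
      then show ?thesis using coef_l[of l' k' m']
        by (simp add: tau_generators e2_w f2_w form_left form_right form_w_w
            bar_shift sb_nonzero field_simps)
    next
      case 2
      then show ?thesis using coef_k_m[of m' "k + 1" l]
        by (simp add: tau_generators e2_w f2_w form_left form_right form_w_w
            bar_shift sb_nonzero field_simps)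
    next
      case 3
      then show ?thesis
        by (cases m) (auto simp: tau_generators e2_w f2_w form_left form_right form_w_w)
    qed
  qed
qed

text \<open>The form is symmetric and \<open>tau\<close> an involution, so the negative root vectors
  follow from the positive ones.\<close>

lemma invariant_tau: "invariant X \<Longrightarrow> invariant (tau X)"
  unfolding invariant_def tau_tau by (metis form_commute add.inverse_inverse)

lemma invariant_sl3:
  assumes "X \<in> sl3"
  shows "invariant X"
proof (rule sl3_generator_induct[OF assms])
  show "invariant (mat_scale c X)" if "invariant X" for c X
    using that by (simp add: invariant_def tau_linear M_act_matrix_linear form_left form_right)
  \<comment> \<open>The scalar is needed because \<open>tau e\<^sub>1\<^sub>2\<close> is
    \<open>- f\<^sub>1\<^sub>2\<close>.\<close>
  then have "invariant (mat_scale (- 1) (tau e\<^sub>1\<^sub>2))"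
    by (simp only: invariant_tau[OF invariant_e12])
  moreover have "mat_scale (- 1) (tau e\<^sub>1\<^sub>2) = f\<^sub>1\<^sub>2"
    by (simp add: tau_generators mat_scale_def vec_eq_iff)
  ultimately show "invariant X" if "X \<in> sl3_generators" for X
    using that invariant_e1 invariant_e2 invariant_e12 invariant_h1 invariant_h2
      invariant_tau[OF invariant_e1] invariant_tau[OF invariant_e2]
    by (auto simp: sl3_generators_def tau_generators)
  show "invariant (X + Y)" if "invariant X" "invariant Y" for X Y
    using that by (simp add: invariant_def tau_linear M_act_matrix_linear form_left form_right)
qed


section \<open>Joint eigenspaces and the restricted dual\<close>

abbreviation "M \<equiv> M_rep \<mu>\<^sub>1 \<mu>\<^sub>2"

definition eigenvalues :: "int \<times> int \<times> nat \<Rightarrow> complex \<times> complex \<times> complex" where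
  "eigenvalues = (\<lambda>(k, l, m). (- (2 * (kb k + of_nat m) - (lb l + of_nat m)),
     - (2 * (lb l + of_nat m) - (kb k + of_nat m)), - of_nat m * (sb k l + of_nat m - 1)))"

lemma w_joint_eigenspace: "w k l m \<in> joint_eigenspace M (eigenvalues (k, l, m))"
  by (simp add: joint_eigenspace_def eigenvalues_def M_rep_def h1_w h2_w f12_e12_w)

text \<open>The two weights determine k + m and l + m. Equality of the third eigenvalues then reads
  (m - m') (s + m - m' - 1) = 0, and the second factor is nonzero because s is not an
  integer.\<close>

lemma eigenvalues_inject:
  assumes "eigenvalues b = eigenvalues b'"
  shows "b = b'"
proof -
  obtain k l m k' l' m' where b: "b = (k, l, m)" "b' = (k', l', m')" by (cases b, cases b')
  from assms have *: "2 * (kb k + of_nat m) - (lb l + of_nat m) = 2 * (kb k' + of_nat m') - (lb l' + of_nat m')"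
    "2 * (lb l + of_nat m) - (kb k + of_nat m) = 2 * (lb l' + of_nat m') - (kb k' + of_nat m')"
    and c: "of_nat m * (sb k l + of_nat m - 1) = of_nat m' * (sb k' l' + of_nat m' - 1)"
    unfolding b eigenvalues_def prod.case prod.inject neg_equal_iff_equal
    by (elim conjE; simp)+
  have kl: "kb k' = kb k + of_nat m - of_nat m'" "lb l' = lb l + of_nat m - of_nat m'"
    using * by algebra+
  have "(of_nat m - of_nat m') * (sb k l + of_int (int m - int m' - 1)) = 0"
    using c unfolding sb_def kl by (simp add: algebra_simps)
  then have "of_nat m = (of_nat m' :: complex)"
    using sb_add_int_nonzero[of k l "int m - int m' - 1"] by simp
  then have m: "m = m'" by simp
  then show ?thesis using kl by (simp add: b kb_def lb_def)
qed

text \<open>The three operators are diagonal in the basis \<open>w\<close>, so composing one with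
  \<open>coord b\<close> multiplies \<open>coord b\<close> by its eigenvalue. A component in which
  \<theta> differs from \<open>eigenvalues b\<close> forces the coordinate to vanish.\<close>

lemma coord_joint_eigenspace:
  assumes "v \<in> joint_eigenspace M \<theta>" "\<theta> \<noteq> eigenvalues b"
  shows "coord b v = 0"
proof -
  obtain k l m where b: "b = (k, l, m)" by (cases b)
  obtain p q r where \<theta>: "\<theta> = (p, q, r)" by (cases \<theta>)
  obtain p' q' r' where e: "eigenvalues b = (p', q', r')" by (cases "eigenvalues b")
  have diagonal: "coord b (f v) = c * coord b v"
    if "Vector_Spaces.linear M_scale M_scale f" "\<And>k l m. f (w k l m) = d k l m \<cdot> w k l m"
      "d k l m = c" for f c and d :: "int \<Rightarrow> int \<Rightarrow> nat \<Rightarrow> complex"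
    by (rule linear_eq_on_w[OF
          Vector_Spaces.linear_compose[OF that(1) linear_coord, unfolded o_def]])
      (use that(2,3) linear_coord[of b] in
        \<open>auto simp: Vector_Spaces.linear_iff coord_w coord_scale b algebra_simps\<close>)
  have "coord b (act h\<^sub>1 v) = p' * coord b v"
    by (rule diagonal[OF linear_M_act h1_w]) (use e in \<open>simp add: eigenvalues_def b\<close>)
  moreover have "coord b (act h\<^sub>2 v) = q' * coord b v"
    by (rule diagonal[OF linear_M_act h2_w]) (use e in \<open>simp add: eigenvalues_def b\<close>)
  moreover have "coord b (act f\<^sub>1\<^sub>2 (act e\<^sub>1\<^sub>2 v)) = r' * coord b v"
    by (rule diagonal[OF Vector_Spaces.linear_compose[OF linear_M_act linear_M_act, unfolded o_def] f12_e12_w])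
      (use e in \<open>simp add: eigenvalues_def b\<close>)
  moreover have "act h\<^sub>1 v = p \<cdot> v" "act h\<^sub>2 v = q \<cdot> v" "act f\<^sub>1\<^sub>2 (act e\<^sub>1\<^sub>2 v) = r \<cdot> v"
    using assms(1) by (auto simp: \<theta> joint_eigenspace_def M_rep_def)
  ultimately show ?thesis
    using assms(2) by (auto simp: \<theta> e coord_scale)
qed

lemma functionals_M: "\<eta> \<in> functionals M \<longleftrightarrow> Vector_Spaces.linear M_scale (*) \<eta>"
  by (auto simp: functionals_def M_rep_def Vector_Spaces.linear_iff M_vector_space vector_space_times)

lemma linear_form_map: "Vector_Spaces.linear M_scale functional_scale form"
  by (simp add: Vector_Spaces.linear_iff M_vector_space vector_space_functional_scale fun_eq_iff
      form_left functional_scale_def)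

lemma coord_eigenspace_dual: "coord b \<in> eigenspace_dual M (eigenvalues b)"
  by (auto simp: eigenspace_dual_def functionals_M linear_coord coord_joint_eigenspace)

lemma form_in_dual: "form v \<in> rep_carrier (dual_rep M)"
proof -
  interpret V: vector_space functional_scale by (rule vector_space_functional_scale)
  have "coord b \<in> (\<Union>\<theta>. eigenspace_dual M \<theta>)" for b
    using coord_eigenspace_dual by (rule UN_I[OF UNIV_I])
  then have span: "coord b \<in> V.span (\<Union>\<theta>. eigenspace_dual M \<theta>)" for b
    by (rule V.span_base)
  have "form v = (\<Sum>b\<in>Poly_Mapping.keys (coords v). functional_scale (coef b * coord b v) (coord b))"
    by (rule ext) (simp add: form_def functional_scale_def sum_apply)
  also have "\<dots> \<in> V.span (\<Union>\<theta>. eigenspace_dual M \<theta>)"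
    by (intro V.span_sum V.span_scale span)
  finally show ?thesis by (simp add: dual_rep_def)
qed

lemma eigenspace_dual_subset_range_form:
  assumes "\<And>b. coef b \<noteq> 0"
  shows "eigenspace_dual M \<theta> \<subseteq> range form"
proof
  fix \<eta> assume \<eta>: "\<eta> \<in> eigenspace_dual M \<theta>"
  then have lin: "Vector_Spaces.linear M_scale (*) \<eta>"
    by (simp add: eigenspace_dual_def functionals_M)
  have vanish: "\<eta> (w k l m) = 0" if "eigenvalues (k, l, m) \<noteq> \<theta>" for k l m
    using \<eta> that w_joint_eigenspace unfolding eigenspace_dual_def by blast
  show "\<eta> \<in> range form"
  proof (cases "\<exists>k l m. eigenvalues (k, l, m) = \<theta>")
    case True
    then obtain k l m where \<theta>: "eigenvalues (k, l, m) = \<theta>" by blast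
    \<comment> \<open>The functional vanishes on every other basis vector, since the eigenvalues
      separate them; the scalar is fixed by comparing values at \<open>w k l m\<close>.\<close>
    have "\<eta> v = form ((\<eta> (w k l m) / coef (k, l, m)) \<cdot> w k l m) v" for v
    proof (rule linear_eq_on_w[OF lin linear_form])
      fix k' l' m'
      show "\<eta> (w k' l' m') = form ((\<eta> (w k l m) / coef (k, l, m)) \<cdot> w k l m) (w k' l' m')"
        using vanish[of k' l' m'] eigenvalues_inject[of "(k', l', m')" "(k, l, m)"] assms
        by (auto simp: \<theta> form_left form_w_w)
    qed
    then show ?thesis by blast
  next
    case False
    have "\<eta> v = form 0 v" for v
      by (rule linear_eq_on_w[OF lin linear_form])
        (use False vanish form_left(2)[of 0 0] in \<open>auto simp: M_scale_laws\<close>)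
    then show ?thesis by blast
  qed
qed

section \<open>The isomorphism for nonintegral parameters\<close>

lemma isomorphic_dual:
  assumes "\<mu>\<^sub>1 \<notin> \<int>" "\<mu>\<^sub>2 \<notin> \<int>"
  shows "sl3_isomorphic M (dual_rep M)"
proof -
  note coef = coef_nonzero[OF assms]
  interpret V: vector_space functional_scale by (rule vector_space_functional_scale)
  interpret F: Vector_Spaces.linear M_scale functional_scale form by (rule linear_form_map)
  have "inj form"
  proof (rule injI)
    fix v x assume "form v = form x"
    then have "form (v - x) y = 0" for y by (simp add: form_left)
    then have "coord b (v - x) = 0" for b
      using form_w[of "v - x"] coef by (cases b) (metis mult_eq_0_iff)
    then show "v = x" using coord_eq_0[of "v - x"] by simp
  qed
  moreover have "range form = rep_carrier (dual_rep M)"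
  proof
    show "range form \<subseteq> rep_carrier (dual_rep M)" using form_in_dual by blast
    show "rep_carrier (dual_rep M) \<subseteq> range form"
      unfolding dual_rep_def sl3_rep.simps
      by (intro V.span_minimal UN_least eigenspace_dual_subset_range_form coef
          F.subspace_image F.vs1.subspace_UNIV)
  qed
  ultimately have "bij_betw form (rep_carrier M) (rep_carrier (dual_rep M))"
    by (simp add: bij_betw_def M_rep_def)
  moreover have "form (act X v) = rep_act (dual_rep M) X (form v)" if "X \<in> sl3" for X v
    using invariant_sl3[OF that] by (simp add: invariant_def dual_rep_def M_rep_def fun_eq_iff)
  ultimately show ?thesis
    unfolding sl3_isomorphic_def
    by (intro exI[of _ form]) (auto simp: M_rep_def dual_rep_def F.add F.scale)
qed

section \<open>Integral parameters exclude an isomorphism\<close>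

lemma dual_carrier_linear:
  assumes "\<eta> \<in> rep_carrier (dual_rep M)"
  shows "Vector_Spaces.linear M_scale (*) \<eta>"
proof -
  interpret V: vector_space functional_scale by (rule vector_space_functional_scale)
  have "V.subspace (functionals M)"
    by (rule V.subspaceI)
      (auto simp: functionals_M Vector_Spaces.linear_iff M_vector_space vector_space_times
        functional_scale_def algebra_simps)
  then have "rep_carrier (dual_rep M) \<subseteq> functionals M"
    unfolding dual_rep_def sl3_rep.simps eigenspace_dual_def
    by (intro V.span_minimal UN_least) simp_all
  then show ?thesis using assms functionals_M by blast
qed

lemma isomorphic_dual_imp:
  assumes "sl3_isomorphic M (dual_rep M)"
  shows "\<mu>\<^sub>1 \<notin> \<int> \<and> \<mu>\<^sub>2 \<notin> \<int>"
proof -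
  from assms obtain \<phi> where bij: "bij_betw \<phi> UNIV (rep_carrier (dual_rep M))"
    and scale: "\<And>c v. \<phi> (c \<cdot> v) = (\<lambda>x. c * \<phi> v x)"
    and equivariant: "\<And>X v x. X \<in> sl3 \<Longrightarrow> \<phi> (act X v) x = - \<phi> v (act (tau X) x)"
    unfolding sl3_isomorphic_def by (auto simp: M_rep_def dual_rep_def functional_scale_def)
  have lin: "Vector_Spaces.linear M_scale (*) (\<phi> v)" for v
    using bij by (intro dual_carrier_linear) (auto simp: bij_betw_def)
  then have lin_simps: "\<phi> v (x + y) = \<phi> v x + \<phi> v y" "\<phi> v (c \<cdot> x) = c * \<phi> v x" for v x y c
    by (simp_all add: Vector_Spaces.linear_iff)
  have uminus: "\<phi> v (- x) = - \<phi> v x" for v x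
    using lin_simps(1)[of v x "- x"] lin_simps(2)[of v 0 0]
    by (simp add: M_scale_laws eq_neg_iff_add_eq_0 add.commute)
  have zero: "\<phi> 0 x = 0" for x using scale[of 0 0] by (simp add: M_scale_laws)
  \<comment> \<open>Because \<open>e\<^sub>1\<^sub>2\<close> kills \<open>w k l 0\<close>, its image
    under \<phi> kills the range of \<open>f\<^sub>1\<^sub>2\<close>, hence every basis vector with
    positive last index.\<close>
  have f12: "\<phi> (w k l 0) (act f\<^sub>1\<^sub>2 x) = 0" for k l x
    using equivariant[of "e\<^sub>1\<^sub>2" "w k l 0" x]
    by (simp add: generators_in_sl3 e12_w M_scale_laws zero tau_generators M_act_uminus_matrix uminus)
  then have Suc: "\<phi> (w k l 0) (w k' l' (Suc m)) = 0" for k l k' l' m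
    by (simp add: w.simps lin_simps)
  \<comment> \<open>Vectors \<open>w k' l' 0\<close> with different indices have different weights
    and pair to 0. If the diagonal value vanished as well, the whole functional would be 0, against
    injectivity of \<phi>.\<close>
  have nonzero: "\<phi> (w k l 0) (w k l 0) \<noteq> 0" for k l
  proof
    assume *: "\<phi> (w k l 0) (w k l 0) = 0"
    have weights: "\<phi> (w k l 0) (w k' l' 0) = 0" if "(k', l') \<noteq> (k, l)" for k' l'
    proof -
      have "(2 * kb k - lb l) * \<phi> (w k l 0) (w k' l' 0) = (2 * kb k' - lb l') * \<phi> (w k l 0) (w k' l' 0)"
        using equivariant[of "h\<^sub>1" "w k l 0" "w k' l' 0"]
        by (simp add: generators_in_sl3 h1_w scale lin_simps tau_generators M_act_uminus_matrix
            uminus algebra_simps)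
      moreover have "(2 * lb l - kb k) * \<phi> (w k l 0) (w k' l' 0) = (2 * lb l' - kb k') * \<phi> (w k l 0) (w k' l' 0)"
        using equivariant[of "h\<^sub>2" "w k l 0" "w k' l' 0"]
        by (simp add: generators_in_sl3 h2_w scale lin_simps tau_generators M_act_uminus_matrix
            uminus algebra_simps)
      moreover have "2 * kb k - lb l \<noteq> 2 * kb k' - lb l' \<or> 2 * lb l - kb k \<noteq> 2 * lb l' - kb k'"
      proof (rule ccontr)
        assume "\<not> ?thesis"
        then have "kb k = kb k'" "lb l = lb l'" by algebra+
        then show False using that by (simp add: kb_def lb_def)
      qed
      ultimately show ?thesis by auto
    qed
    have "\<phi> (w k l 0) x = \<phi> 0 x" for x
    proof (rule linear_eq_on_w[OF lin lin])
      fix k' l' m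
      show "\<phi> (w k l 0) (w k' l' m) = \<phi> 0 (w k' l' m)"
        using * weights[of k' l'] by (cases m) (auto simp: zero Suc)
    qed
    then have "\<phi> (w k l 0) = \<phi> 0" by blast
    then have "w k l 0 = 0" using bij by (simp add: bij_betw_def inj_eq)
    then have "coord (k, l, 0) (w k l 0) = 0"
      using coord_scale[of "(k, l, 0)" 0 0] by (simp add: M_scale_laws)
    then show False by (simp add: coord_w)
  qed
  have "\<mu>\<^sub>1 \<noteq> of_int k" for k
  proof
    assume "\<mu>\<^sub>1 = of_int k"
    then have k: "kb k = 0" unfolding kb_def by simp
    \<comment> \<open>Here \<open>e\<^sub>1\<close> kills \<open>w k 0 0\<close>. Yet
      \<open>f\<^sub>1\<close> sends \<open>w (k - 1) 0 0\<close> to 2 / (s - 1) times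
      \<open>w k 0 0\<close>, with s = \<open>sb (k - 1) 0\<close>, plus a term of last index 1, on
      which the functional vanishes. The value 0 for the other index is an arbitrary choice.\<close>
    have "\<phi> (w k 0 0) (act f\<^sub>1 (w (k - 1) 0 0)) = 0"
      using equivariant[of "e\<^sub>1" "w k 0 0" "w (k - 1) 0 0"]
      by (simp add: generators_in_sl3 e1_w k M_scale_laws zero tau_generators)
    then show False
      using nonzero[of k 0] by (simp add: f1_w bar_shift k lin_simps Suc sb_nonzero)
  qed
  moreover have "\<mu>\<^sub>2 \<noteq> of_int l" for l
  proof
    assume "\<mu>\<^sub>2 = of_int l"
    then have l: "lb l = 0" unfolding lb_def by simp
    have "\<phi> (w 0 l 0) (act f\<^sub>2 (w 0 (l - 1) 0)) = 0"
      using equivariant[of "e\<^sub>2" "w 0 l 0" "w 0 (l - 1) 0"]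
      by (simp add: generators_in_sl3 e2_w l M_scale_laws zero tau_generators)
    then show False
      using nonzero[of 0 l] by (simp add: f2_w bar_shift l lin_simps Suc sb_nonzero)
  qed
  ultimately show ?thesis by (auto elim!: Ints_cases)
qed

end

theorem theorem7p2:
  fixes \<mu>\<^sub>1 \<mu>\<^sub>2 :: complex
  assumes "\<mu>\<^sub>1 + \<mu>\<^sub>2 \<notin> \<int>"
  shows "sl3_isomorphic (M_rep \<mu>\<^sub>1 \<mu>\<^sub>2) (dual_rep (M_rep \<mu>\<^sub>1 \<mu>\<^sub>2)) \<longleftrightarrow> \<mu>\<^sub>1 \<notin> \<int> \<and> \<mu>\<^sub>2 \<notin> \<int>"
proof -
  interpret M_nonintegral_sum \<mu>\<^sub>1 \<mu>\<^sub>2 by unfold_locales (rule assms)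
  show ?thesis using isomorphic_dual isomorphic_dual_imp by blast
qed

end
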